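(* Let $x\in D$ be fixed and let $X$ be an affine process relative to $(\mathcal F_t^x)$ with càdlàg paths. Then $(\mathcal F_t^x)$ is right-continuous, i.e. $\bigcap_{s>t}\mathcal F_s^x=\mathcal F_t^x$ for every $t\ge0$.
   Context: Spaces. $V$ is an $n$-dimensional real vector space with scalar product $\langle\cdot,\cdot\rangle$ and norm $\|\cdot\|$; $\langle\cdot,\cdot\rangle$ is extended bilinearly (without complex conjugation) to $V+\mathrm iV$. The state space $D\subseteq V$ is closed, non-empty and contains $n+1$ affinely independent elements; $\mathcal D$ is its Borel $\sigma$-algebra. $\Delta\notin D$ is a cemetery state, $D_\Delta=D\cup\{\Delta\}$, $\mathcal D_\Delta=\sigma(\mathcal D,\{\Delta\})$, with the conventions $\|\Delta\|=\infty$ and $f(\Delta)=0$ for any other function $f$ on $D$. $\mathbb R_+=[0,\infty)$. Put $\mathcal U=\{u\in V+\mathrm iV: x\mapsto e^{\langle u,x\rangle}\text{ is bounded on }D\}$ and $\mathcal U^m=\{u\in V+\mathrm iV:\sup_{x\in D}e^{\langle\mathrm{Re}\,u,x\rangle}\le m\}$, $m\ge1$. Markov processes. $X=(X_t)_{t\ge0}$ is a $D_\Delta$-valued process such that $X_s(\omega)=\Delta$ implies $X_t(\omega)=\Delta$ for $t\ge s$; $\mathcal F_t^0=\sigma(X_s,s\le t)$, $\mathcal F^0=\bigvee_t\mathcal F_t^0$; $(\mathbb P_x)_{x\in D_\Delta}$ are probability measures on $(\Omega,\mathcal F^0)$. $X$ is a time-homogeneous Markov process relative to a filtration $(\mathcal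 F_t)$ with $\mathcal F_t\supseteq\mathcal F_t^0$ if $\mathbb E_x[f(X_{t+s})|\mathcal F_s]=\mathbb E_{X_s}[f(X_t)]=\int_D f(\xi)p_t(X_s,d\xi)$ $\mathbb P_x$-a.s. for all $s,t\ge0$, $x\in D_\Delta$ and bounded measurable $f:D_\Delta\to\mathbb R$, where $(p_t)$ is a transition function: kernels $p_t:D_\Delta\times\mathcal D_\Delta\to[0,1]$ such that $p_t(x,\cdot)$ is a measure with $p_t(x,D)\le1$, $p_t(x,\{\Delta\})=1-p_t(x,D)$, $p_t(\Delta,\{\Delta\})=1$, $p_0(x,\cdot)=\delta_x$, $x\mapsto p_t(x,\Gamma)$ is measurable, and the Chapman–Kolmogorov equation holds. Affine processes. Such an $X$ is affine if (1) it is stochastically continuous: $\lim_{s\to t}p_s(x,\cdot)=p_t(x,\cdot)$ weakly on $D$ for all $t\ge0$, $x\in D$; (2) there are functions $\Phi:\mathbb R_+\times\mathcal U\to\mathbb C$, $\psi:\mathbb R_+\times\mathcal U\to V+\mathrm iV$ such that for every $x\in D$, $m\ge1$ the map $(t,u)\mapsto\langle\psi(t,u),x\rangle$ is locally continuous on the subset of $\mathbb R_+\times\mathcal U^m$ where $\Phi$ does not vanish, denoted $\mathcal Q^m=\{(t,u)\in\mathbb R_+\times\mathcal U^m:\Phi(s,u)\ne0\ \forall s\in[0,t]\}$, and $\mathbb E_x[e^{\langle u,X_t\rangle}]=\int_De^{\langle u,\xi\rangle}p_t(x,d\xi)=\Phi(t,u)e^{\langle\psi(t,u),x\rangle}$ for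 all $x\in D$, $(t,u)\in\mathbb R_+\times\mathcal U$. Path space and augmentation. $X$ is realized as the canonical process $X_t(\omega)=\omega(t)$ on the space $\Omega=\mathbb D(D_\Delta)$ of càdlàg paths $\omega:\mathbb R_+\to D_\Delta$ with $\omega(t)=\Delta$ for $t\ge s$ whenever $\|\omega(s-)\|=\infty$ or $\|\omega(s)\|=\infty$. $\mathcal F^x$ is the completion of $\mathcal F^0$ with respect to $\mathbb P_x$, and $\mathcal F_t^x=\sigma(\mathcal F_t^0,\mathcal N(\mathcal F^x))$ with $\mathcal N(\mathcal F^x)$ the $\mathbb P_x$-null sets in $\mathcal F^x$. *)

theory Defs
  imports "HOL-Probability.Probability"
begin

section \<open>State space and complexification\<close>

definition state_space :: "'a::euclidean_space set \<Rightarrow> bool" where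
  "state_space D \<longleftrightarrow> closed D \<and> D \<noteq> {} \<and>
     (\<exists>S\<subseteq>D. \<not> affine_dependent S \<and> card S = DIM('a) + 1)"

text \<open>The pair \<open>(a, b)\<close> stands for \<open>a + i b\<close> in \<open>V + i V\<close>. Only pairings of an element of
  \<open>V + i V\<close> with a real vector occur below, so the bilinear extension of the scalar product is
  given in that case.\<close>

type_synonym 'a complexified = "'a \<times> 'a"

definition cpair :: "'a::euclidean_space complexified \<Rightarrow> 'a \<Rightarrow> complex" where
  "cpair u x = Complex (fst u \<bullet> x) (snd u \<bullet> x)"

definition bounded_exponents :: "'a::euclidean_space set \<Rightarrow> 'a complexified set" where
  "bounded_exponents D = {u. bounded ((\<lambda>x. exp (cpair u x)) ` D)}"

text \<open>The supremum is taken in the extended reals, so that it is infinite on unbounded families.\<close>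

definition bounded_exponents_by :: "'a::euclidean_space set \<Rightarrow> real \<Rightarrow> 'a complexified set" where
  "bounded_exponents_by D m = {u. (SUP x\<in>D. ereal (exp (fst u \<bullet> x))) \<le> ereal m}"

section \<open>Adjoining the cemetery state\<close>

text \<open>The cemetery is \<open>None\<close>. The topology on \<open>D\<close> with the cemetery adjoined is the one given by
  the convention that the cemetery has infinite norm: since \<open>D\<close> is closed, points of \<open>D\<close> tend to
  \<open>None\<close> in the Alexandroff compactification iff their norm tends to infinity; if \<open>D\<close> is compact,
  then \<open>None\<close> is isolated.\<close>

definition cemetery_topology :: "'a::euclidean_space set \<Rightarrow> 'a option topology" where
  "cemetery_topology D = Alexandroff_compactification (top_of_set D)"

definition cemetery_measurable :: "'a::euclidean_space set \<Rightarrow> 'a option measure" where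
  "cemetery_measurable D =
     sigma (insert None (Some ` D)) (insert {None} ((`) Some ` sets (restrict_space borel D)))"

text \<open>Functions on \<open>D\<close> are extended by \<open>0\<close> to the cemetery.\<close>

abbreviation zero_ext :: "('a \<Rightarrow> 'b::zero) \<Rightarrow> 'a option \<Rightarrow> 'b" where
  "zero_ext f \<equiv> case_option 0 f"

section \<open>Path space\<close>

type_synonym 'a path = "real \<Rightarrow> 'a option"

text \<open>Paths are indexed by the nonnegative reals and \<open>undefined\<close> at negative times. The last two
  conditions say that a path is absorbed in the cemetery at a time at which its value, or its left
  limit, is the cemetery.\<close>

definition cadlag_paths :: "'a::euclidean_space set \<Rightarrow> 'a path set" where
  "cadlag_paths D = {\<omega> \<in> {0..} \<rightarrow>\<^sub>E insert None (Some ` D).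
     (\<forall>t\<ge>0. limitin (cemetery_topology D) \<omega> (\<omega> t) (at_right t)) \<and>
     (\<forall>t>0. \<exists>l. limitin (cemetery_topology D) \<omega> l (at_left t)) \<and>
     (\<forall>s\<ge>0. \<omega> s = None \<longrightarrow> (\<forall>t\<ge>s. \<omega> t = None)) \<and>
     (\<forall>s>0. limitin (cemetery_topology D) \<omega> None (at_left s) \<longrightarrow> (\<forall>t\<ge>s. \<omega> t = None))}"

definition natural_filtration :: "'a::euclidean_space set \<Rightarrow> real \<Rightarrow> 'a path measure" where
  "natural_filtration D t = sigma (cadlag_paths D)
     (\<Union>s\<in>{0..t}. sets (vimage_algebra (cadlag_paths D) (\<lambda>\<omega>. \<omega> s) (cemetery_measurable D)))"

definition path_algebra :: "'a::euclidean_space set \<Rightarrow> 'a path measure" where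
  "path_algebra D = sigma (cadlag_paths D) (\<Union>t\<in>{0..}. sets (natural_filtration D t))"

definition path_laws ::
  "'a::euclidean_space set \<Rightarrow> ('a option \<Rightarrow> 'a path measure) \<Rightarrow> bool" where
  "path_laws D P \<longleftrightarrow> (\<forall>x\<in>insert None (Some ` D). P x \<in> space (prob_algebra (path_algebra D)))"

definition augmented_filtration ::
  "'a::euclidean_space set \<Rightarrow> ('a option \<Rightarrow> 'a path measure) \<Rightarrow> 'a option \<Rightarrow> real \<Rightarrow> 'a path measure"
  where
  "augmented_filtration D P x t =
     sigma (cadlag_paths D) (sets (natural_filtration D t) \<union> null_sets (completion (P x)))"

section \<open>Markov processes\<close>

definition transition_function ::
  "'a::euclidean_space set \<Rightarrow> (real \<Rightarrow> 'a option \<Rightarrow> 'a option measure) \<Rightarrow> bool" where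
  "transition_function D p \<longleftrightarrow>
     (\<forall>t\<ge>0. p t \<in> cemetery_measurable D \<rightarrow>\<^sub>M subprob_algebra (cemetery_measurable D)) \<and>
     (\<forall>t\<ge>0. \<forall>x\<in>insert None (Some ` D).
        measure (p t x) {None} = 1 - measure (p t x) (Some ` D)) \<and>
     (\<forall>t\<ge>0. measure (p t None) {None} = 1) \<and>
     (\<forall>x\<in>insert None (Some ` D). p 0 x = return (cemetery_measurable D) x) \<and>
     (\<forall>s\<ge>0. \<forall>t\<ge>0. \<forall>x\<in>insert None (Some ` D). \<forall>A\<in>sets (cemetery_measurable D).
        emeasure (p (t + s) x) A = (\<integral>\<^sup>+ \<xi>. emeasure (p s \<xi>) A \<partial>p t x))"

definition admissible_filtration ::
  "'a::euclidean_space set \<Rightarrow> 'a path measure \<Rightarrow> (real \<Rightarrow> 'a path measure) \<Rightarrow> bool" where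
  "admissible_filtration D Q F \<longleftrightarrow>
     (\<forall>t\<ge>0. subalgebra (completion Q) (F t) \<and> sets (natural_filtration D t) \<subseteq> sets (F t)) \<and>
     (\<forall>s t. 0 \<le> s \<longrightarrow> s \<le> t \<longrightarrow> sets (F s) \<subseteq> sets (F t))"

text \<open>The Markov property of the canonical process under the single law \<open>P x\<close>. Conditional
  expectations are taken under the completed law, as the \<open>\<sigma>\<close>-algebras of \<open>F\<close> may contain null
  sets that are not in \<open>path_algebra D\<close>. The integral with respect to the transition function is
  over the whole of \<open>D\<close> with the cemetery adjoined; it is the integral over \<open>D\<close> if \<open>f None = 0\<close>.\<close>

definition markov_property ::
  "'a::euclidean_space set \<Rightarrow> ('a option \<Rightarrow> 'a path measure) \<Rightarrow>
   (real \<Rightarrow> 'a option \<Rightarrow> 'a option measure) \<Rightarrow> 'a option \<Rightarrow> (real \<Rightarrow> 'a path measure) \<Rightarrow> bool"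
  where
  "markov_property D P p x F \<longleftrightarrow>
     (\<forall>s\<ge>0. \<forall>t\<ge>0. \<forall>f :: 'a option \<Rightarrow> real.
        f \<in> borel_measurable (cemetery_measurable D) \<longrightarrow>
        bounded (f ` insert None (Some ` D)) \<longrightarrow>
        (AE \<omega> in P x.
           real_cond_exp (completion (P x)) (F s) (\<lambda>\<omega>. f (\<omega> (t + s))) \<omega>
             = (\<integral>\<omega>'. f (\<omega>' t) \<partial>P (\<omega> s)) \<and>
           (\<integral>\<omega>'. f (\<omega>' t) \<partial>P (\<omega> s)) = (\<integral>\<xi>. f \<xi> \<partial>p t (\<omega> s))))"

text \<open>The filtration may depend on the starting point \<open>x\<close>, and the Markov property under the law
  \<open>P x\<close> is required relative to \<open>F x\<close>. This is needed for augmented filtrations: the null sets of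
  one law \<open>P x\<close> need be neither measurable nor null for the completion of another one. A filtration
  not depending on \<open>x\<close> is covered as a constant family.\<close>

definition markov_process ::
  "'a::euclidean_space set \<Rightarrow> ('a option \<Rightarrow> 'a path measure) \<Rightarrow>
   (real \<Rightarrow> 'a option \<Rightarrow> 'a option measure) \<Rightarrow> ('a option \<Rightarrow> real \<Rightarrow> 'a path measure) \<Rightarrow> bool"
  where
  "markov_process D P p F \<longleftrightarrow> path_laws D P \<and> transition_function D p \<and>
     (\<forall>x\<in>insert None (Some ` D).
        admissible_filtration D (P x) (F x) \<and> markov_property D P p x (F x))"

section \<open>Affine processes\<close>

definition stochastically_continuous ::
  "'a::euclidean_space set \<Rightarrow> (real \<Rightarrow> 'a option \<Rightarrow> 'a option measure) \<Rightarrow> bool" where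
  "stochastically_continuous D p \<longleftrightarrow>
     (\<forall>t\<ge>0. \<forall>x\<in>D. \<forall>f :: 'a \<Rightarrow> real. continuous_on D f \<longrightarrow> bounded (f ` D) \<longrightarrow>
        ((\<lambda>s. \<integral>\<xi>. zero_ext f \<xi> \<partial>p s (Some x)) \<longlongrightarrow> (\<integral>\<xi>. zero_ext f \<xi> \<partial>p t (Some x)))
          (at t within {0..}))"

definition nonvanishing_domain ::
  "'a::euclidean_space set \<Rightarrow> (real \<Rightarrow> 'a complexified \<Rightarrow> complex) \<Rightarrow> real \<Rightarrow>
   (real \<times> 'a complexified) set" where
  "nonvanishing_domain D \<Phi> m =
     {(t, u). 0 \<le> t \<and> u \<in> bounded_exponents_by D m \<and> (\<forall>s\<in>{0..t}. \<Phi> s u \<noteq> 0)}"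

definition exponentially_affine ::
  "'a::euclidean_space set \<Rightarrow> ('a option \<Rightarrow> 'a path measure) \<Rightarrow>
   (real \<Rightarrow> 'a option \<Rightarrow> 'a option measure) \<Rightarrow>
   (real \<Rightarrow> 'a complexified \<Rightarrow> complex) \<Rightarrow> (real \<Rightarrow> 'a complexified \<Rightarrow> 'a complexified) \<Rightarrow> bool"
  where
  "exponentially_affine D P p \<Phi> \<psi> \<longleftrightarrow>
     (\<forall>x\<in>D. \<forall>m\<ge>1. continuous_on (nonvanishing_domain D \<Phi> m) (\<lambda>(t, u). cpair (\<psi> t u) x)) \<and>
     (\<forall>x\<in>D. \<forall>t\<ge>0. \<forall>u\<in>bounded_exponents D.
        (\<integral>\<omega>. zero_ext (\<lambda>y. exp (cpair u y)) (\<omega> t) \<partial>P (Some x))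
          = (\<integral>\<xi>. zero_ext (\<lambda>y. exp (cpair u y)) \<xi> \<partial>p t (Some x)) \<and>
        (\<integral>\<xi>. zero_ext (\<lambda>y. exp (cpair u y)) \<xi> \<partial>p t (Some x))
          = \<Phi> t u * exp (cpair (\<psi> t u) x))"

definition affine_process ::
  "'a::euclidean_space set \<Rightarrow> ('a option \<Rightarrow> 'a path measure) \<Rightarrow>
   (real \<Rightarrow> 'a option \<Rightarrow> 'a option measure) \<Rightarrow> ('a option \<Rightarrow> real \<Rightarrow> 'a path measure) \<Rightarrow> bool"
  where
  "affine_process D P p F \<longleftrightarrow> markov_process D P p F \<and> stochastically_continuous D p \<and>
     (\<exists>\<Phi> \<psi>. exponentially_affine D P p \<Phi> \<psi>)"

end

theory Submission
  imports Defs
begin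

text \<open>Fix \<open>t\<close> and let \<open>A\<close> be an event of \<open>\<F>\<^sub>s\<close> for every \<open>s > t\<close>. The theorem says that \<open>A\<close> agrees
  up to a null set with an event of \<open>\<F>\<^sub>t\<close>, that is, \<open>Z = 1\<^sub>A - E[1\<^sub>A | \<F>\<^sub>t]\<close> vanishes almost surely.
  By construction \<open>Z\<close> is measurable with respect to every \<open>\<F>\<^sub>s\<close>, \<open>s > t\<close>, and orthogonal to all
  bounded \<open>\<F>\<^sub>t\<close>-measurable functions. Since the path \<open>\<sigma>\<close>-algebra is generated by finite-dimensional
  cylinders, it suffices to show that \<open>E[Z f\<^sub>1(X\<^sub>r) \<cdots> f\<^sub>k(X\<^sub>s)] = 0\<close> for all bounded measurable
  \<open>f\<^sub>i\<close> and all times.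

  The core is the case of a single time \<open>b \<ge> t\<close> and of the plane wave \<open>f(y) = exp(i\<langle>v, y\<rangle>)\<close>. The
  Markov property at time \<open>t + e\<close>, where \<open>Z\<close> is already measurable, gives
  \<open>E[Z f(X\<^sub>b\<^sub>+\<^sub>e)] = E[Z h(X\<^sub>t\<^sub>+\<^sub>e)]\<close> with \<open>h(y) = \<integral> f dp\<^sub>b\<^sub>-\<^sub>t(y, \<cdot>)\<close>. Both times are moved by the same
  \<open>e\<close>, so \<open>h\<close> does not depend on \<open>e\<close>. Affinity enters only here: it says that
  \<open>h(y) = \<Phi>(b - t, iv) exp(\<langle>\<psi>(b - t, iv), y\<rangle>)\<close>, which is continuous in \<open>y\<close> (even where \<open>\<Phi>\<close>
  vanishes), so along a right-continuous path \<open>h(X\<^sub>t\<^sub>+\<^sub>e) \<longrightarrow> h(X\<^sub>t)\<close> as \<open>e\<close> decreases to 0; after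
  absorption in the cemetery nothing moves. In the limit \<open>E[Z f(X\<^sub>b)] = E[Z h(X\<^sub>t)] = 0\<close>
  (\<open>germ_orthogonal_single_time\<close>).

  Two steps lead from there to the general case. Plane waves determine a finite measure
  (\<open>finite_measure_eqI_cos\<close>, \<open>measure_determining_state_waves\<close>), so the single-time identity
  extends to all bounded measurable \<open>f\<close>. For several times, the Markov property at the last time
  but one removes the last factor, and induction on the set of times applies, because the property
  is claimed for arbitrary bounded measurable factors (\<open>germ_orthogonal_finite_times\<close>). The passage
  from cylinders to \<open>Z = 0\<close> is \<open>AE_zero_if_orthogonal_to_cylinders\<close>.\<close>

section \<open>Bounded test functions and measure-determining classes\<close>

definition bounded_measurable :: "'a measure \<Rightarrow> ('a \<Rightarrow> real) set" where
  "bounded_measurable M = {f \<in> borel_measurable M. \<exists>B. \<forall>x\<in>space M. \<bar>f x\<bar> \<le> B}"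

lemma bounded_measurableI:
  assumes "f \<in> borel_measurable M" "\<And>x. x \<in> space M \<Longrightarrow> \<bar>f x\<bar> \<le> B"
  shows "f \<in> bounded_measurable M"
  using assms by (auto simp: bounded_measurable_def)

lemma bounded_measurableE:
  assumes "f \<in> bounded_measurable M"
  obtains B where "B \<ge> 0" "\<And>x. x \<in> space M \<Longrightarrow> \<bar>f x\<bar> \<le> B"
proof -
  obtain B where B: "\<forall>x\<in>space M. \<bar>f x\<bar> \<le> B"
    using assms by (auto simp: bounded_measurable_def)
  show thesis
    by (rule that[of "max B 0"]) (use B in \<open>auto simp: le_max_iff_disj\<close>)
qed

lemma bounded_measurable_measurable: "f \<in> bounded_measurable M \<Longrightarrow> f \<in> borel_measurable M"
  by (simp add: bounded_measurable_def)

lemma bounded_measurable_const: "(\<lambda>_. c) \<in> bounded_measurable M"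
  by (rule bounded_measurableI[of _ _ "\<bar>c\<bar>"]) auto

lemma bounded_measurable_indicator: "A \<in> sets M \<Longrightarrow> indicator A \<in> bounded_measurable M"
  by (rule bounded_measurableI[of _ _ 1]) (auto simp: indicator_def)

lemma bounded_measurable_mult:
  assumes f: "f \<in> bounded_measurable M" and g: "g \<in> bounded_measurable M"
  shows "(\<lambda>x. f x * g x) \<in> bounded_measurable M"
proof -
  obtain B where B: "B \<ge> 0" "\<And>x. x \<in> space M \<Longrightarrow> \<bar>f x\<bar> \<le> B"
    using bounded_measurableE[OF f] by metis
  obtain C where C: "C \<ge> 0" "\<And>x. x \<in> space M \<Longrightarrow> \<bar>g x\<bar> \<le> C"
    using bounded_measurableE[OF g] by metis
  show ?thesis
  proof (rule bounded_measurableI[of _ _ "B * C"])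
    show "(\<lambda>x. f x * g x) \<in> borel_measurable M"
      using f g by (intro borel_measurable_times bounded_measurable_measurable)
    show "\<bar>f x * g x\<bar> \<le> B * C" if "x \<in> space M" for x
      unfolding abs_mult using B C that by (intro mult_mono) auto
  qed
qed

lemma bounded_measurable_prod:
  assumes "\<And>i. i \<in> I \<Longrightarrow> f i \<in> bounded_measurable M"
  shows "(\<lambda>x. \<Prod>i\<in>I. f i x) \<in> bounded_measurable M"
  using assms
  by (induction I rule: infinite_finite_induct)
     (auto intro: bounded_measurable_const bounded_measurable_mult)

lemma bounded_measurable_comp:
  assumes f: "f \<in> bounded_measurable N" and X: "X \<in> M \<rightarrow>\<^sub>M N"
  shows "(\<lambda>x. f (X x)) \<in> bounded_measurable M"
proof -
  obtain B where B: "\<And>x. x \<in> space N \<Longrightarrow> \<bar>f x\<bar> \<le> B"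
    using bounded_measurableE[OF f] by metis
  show ?thesis
    by (rule bounded_measurableI[of _ _ B])
       (use B measurable_space[OF X] measurable_compose[OF X bounded_measurable_measurable[OF f]]
        in auto)
qed

lemma bounded_measurable_subalgebra:
  assumes "f \<in> bounded_measurable F" "subalgebra M F"
  shows "f \<in> bounded_measurable M"
  using assms measurable_from_subalg[OF assms(2)]
  by (auto simp: bounded_measurable_def subalgebra_def)

lemma integrable_mult_bounded_measurable:
  assumes Z: "integrable M Z" and f: "f \<in> bounded_measurable M"
  shows "integrable M (\<lambda>x. Z x * f x)"
proof -
  obtain B where B: "\<And>x. x \<in> space M \<Longrightarrow> \<bar>f x\<bar> \<le> B"
    using bounded_measurableE[OF f] by metis
  note [measurable] = bounded_measurable_measurable[OF f]
  show ?thesis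
  proof (rule Bochner_Integration.integrable_bound)
    show "integrable M (\<lambda>x. B * Z x)" using Z by simp
    show "(\<lambda>x. Z x * f x) \<in> borel_measurable M" using Z by measurable
    show "AE x in M. norm (Z x * f x) \<le> norm (B * Z x)"
    proof (rule AE_I2)
      fix x assume "x \<in> space M"
      then have "\<bar>Z x\<bar> * \<bar>f x\<bar> \<le> \<bar>Z x\<bar> * \<bar>B\<bar>" using B[of x] by (intro mult_left_mono) auto
      then show "norm (Z x * f x) \<le> norm (B * Z x)" by (simp add: abs_mult mult.commute)
    qed
  qed
qed

lemma (in finite_measure) integrable_bounded_measurable:
  "f \<in> bounded_measurable M \<Longrightarrow> integrable M f"
  using integrable_mult_bounded_measurable[of M "\<lambda>_. 1" f] by simp

text \<open>Test functions are often available only for a small class, whereas the Markov property has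
  to be iterated with arbitrary bounded functions; measure-determining classes bridge the gap.\<close>
definition measure_determining :: "'a measure \<Rightarrow> ('a \<Rightarrow> real) set \<Rightarrow> bool" where
  "measure_determining E C \<longleftrightarrow>
     (\<forall>\<mu> \<nu>. finite_measure \<mu> \<longrightarrow> finite_measure \<nu> \<longrightarrow> sets \<mu> = sets E \<longrightarrow> sets \<nu> = sets E \<longrightarrow>
        (\<forall>f\<in>C. (\<integral>y. f y \<partial>\<mu>) = (\<integral>y. f y \<partial>\<nu>)) \<longrightarrow> \<mu> = \<nu>)"

lemma measure_determining_indicators:
  assumes G: "Int_stable G" "G \<subseteq> Pow \<Omega>" "\<Omega> \<in> G" and E: "sets E = sigma_sets \<Omega> G"
  shows "measure_determining E (indicator ` G)"
  unfolding measure_determining_def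
proof (intro allI impI)
  fix \<mu> \<nu> :: "'a measure"
  assume fin: "finite_measure \<mu>" "finite_measure \<nu>"
    and sets: "sets \<mu> = sets E" "sets \<nu> = sets E"
    and eq: "\<forall>f\<in>(indicator ` G :: ('a \<Rightarrow> real) set). (\<integral>y. f y \<partial>\<mu>) = (\<integral>y. f y \<partial>\<nu>)"
  interpret \<mu>: finite_measure \<mu> by fact
  interpret \<nu>: finite_measure \<nu> by fact
  have m: "B \<in> sets \<mu>" "B \<in> sets \<nu>" if "B \<in> G" for B
    using that sets E by auto
  show "\<mu> = \<nu>"
  proof (rule measure_eqI_generator_eq[OF G(1,2), where A = "\<lambda>_. \<Omega>"])
    show "sets \<mu> = sigma_sets \<Omega> G" "sets \<nu> = sigma_sets \<Omega> G" using sets E by auto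
    show "emeasure \<mu> B = emeasure \<nu> B" if "B \<in> G" for B
      using bspec[OF eq imageI[OF that]] m[OF that]
      by (simp add: \<mu>.emeasure_eq_measure \<nu>.emeasure_eq_measure Int_absorb2 sets.sets_into_space)
  qed (use G \<mu>.emeasure_finite in auto)
qed

text \<open>The signed measure \<open>B \<mapsto> E[Z 1\<^sub>B(X)]\<close> is the difference of the two finite measures that the
  positive and the negative part of \<open>Z\<close> induce on \<open>E\<close>; if it annihilates a determining class, then
  these two coincide.\<close>
lemma (in finite_measure) determining_orthogonal:
  assumes C: "measure_determining E C" "C \<subseteq> bounded_measurable E"
    and Z: "integrable M Z" and X: "X \<in> M \<rightarrow>\<^sub>M E"
    and orth: "\<And>f. f \<in> C \<Longrightarrow> (\<integral>\<omega>. Z \<omega> * f (X \<omega>) \<partial>M) = 0"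
    and f: "f \<in> bounded_measurable E"
  shows "(\<integral>\<omega>. Z \<omega> * f (X \<omega>) \<partial>M) = 0"
proof -
  define pos where "pos = distr (density M (\<lambda>\<omega>. ennreal (max 0 (Z \<omega>)))) E X"
  define neg where "neg = distr (density M (\<lambda>\<omega>. ennreal (max 0 (- Z \<omega>)))) E X"
  note [measurable] = X borel_measurable_integrable[OF Z]
  have fin: "finite_measure (distr (density M (\<lambda>\<omega>. ennreal (max 0 (Y \<omega>)))) E X)"
    if Y: "integrable M Y" for Y
  proof -
    have [measurable]: "Y \<in> borel_measurable M" using Y by simp
    have "integrable M (\<lambda>\<omega>. max 0 (Y \<omega>))" using Y by simp
    then have "(\<integral>\<^sup>+\<omega>. ennreal (max 0 (Y \<omega>)) \<partial>M) < \<infinity>"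
      by (subst nn_integral_eq_integral) auto
    then have "finite_measure (density M (\<lambda>\<omega>. ennreal (max 0 (Y \<omega>))))"
      by (intro finite_measureI) (simp add: emeasure_density cong: nn_integral_cong)
    then show ?thesis by (rule finite_measure.finite_measure_distr) simp
  qed
  have split: "(\<integral>\<omega>. Z \<omega> * g (X \<omega>) \<partial>M) = (\<integral>y. g y \<partial>pos) - (\<integral>y. g y \<partial>neg)"
    if g: "g \<in> bounded_measurable E" for g
  proof -
    note [measurable] = bounded_measurable_measurable[OF g]
    have gX: "(\<lambda>\<omega>. g (X \<omega>)) \<in> bounded_measurable M" by (rule bounded_measurable_comp[OF g X])
    have "(\<integral>y. g y \<partial>pos) = (\<integral>\<omega>. max 0 (Z \<omega>) * g (X \<omega>) \<partial>M)"
      unfolding pos_def by (subst integral_distr) (auto simp: integral_density simp del: ennreal_max_0 ennreal_max_0')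
    moreover have "(\<integral>y. g y \<partial>neg) = (\<integral>\<omega>. max 0 (- Z \<omega>) * g (X \<omega>) \<partial>M)"
      unfolding neg_def by (subst integral_distr) (auto simp: integral_density simp del: ennreal_max_0 ennreal_max_0')
    moreover have "(\<integral>\<omega>. Z \<omega> * g (X \<omega>) \<partial>M)
        = (\<integral>\<omega>. max 0 (Z \<omega>) * g (X \<omega>) - max 0 (- Z \<omega>) * g (X \<omega>) \<partial>M)"
      by (rule Bochner_Integration.integral_cong) (auto simp: max_def)
    ultimately show ?thesis
      using Z by (simp add: Bochner_Integration.integral_diff integrable_mult_bounded_measurable gX)
  qed
  have "\<forall>f\<in>C. (\<integral>y. f y \<partial>pos) = (\<integral>y. f y \<partial>neg)"
    using orth split C(2) by (metis eq_iff_diff_eq_0 subsetD)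
  then have "pos = neg"
    using C(1) fin[OF Z] fin[of "\<lambda>\<omega>. - Z \<omega>"] Z unfolding measure_determining_def pos_def neg_def
    by simp
  with split[OF f] show ?thesis by simp
qed

section \<open>Uniqueness of the Fourier transform on a Euclidean space\<close>

lemma nonpos_if_le_small_multiples:
  fixes a m :: real
  assumes "\<And>d. d > 0 \<Longrightarrow> a \<le> d * m" "0 \<le> m"
  shows "a \<le> 0"
proof (rule field_le_epsilon)
  fix e :: real assume e: "0 < e"
  have "a \<le> e / (m + 1) * m" using e assms(2) by (intro assms(1)) simp
  also have "\<dots> \<le> e" using e assms(2) by (simp add: field_simps)
  finally show "a \<le> 0 + e" by simp
qed

text \<open>The phase \<open>\<theta>\<close> lets one real family cover both sines and cosines; products of two waves are
  again sums of waves.\<close>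
inductive trigonometric_polynomial :: "('a::real_inner \<Rightarrow> real) \<Rightarrow> bool" where
  wave: "trigonometric_polynomial (\<lambda>y. c * cos (v \<bullet> y + \<theta>))"
| add: "trigonometric_polynomial f \<Longrightarrow> trigonometric_polynomial g \<Longrightarrow>
    trigonometric_polynomial (\<lambda>y. f y + g y)"

lemma trigonometric_polynomial_const: "trigonometric_polynomial (\<lambda>_. c)"
  using wave[of c 0 0] by simp

lemma trigonometric_polynomial_mult:
  assumes "trigonometric_polynomial f" "trigonometric_polynomial g"
  shows "trigonometric_polynomial (\<lambda>y. f y * g y)"
  using assms
proof (induction f rule: trigonometric_polynomial.induct)
  case (wave c v \<theta>)
  from wave show ?case
  proof (induction g rule: trigonometric_polynomial.induct)
    case (wave d w \<phi>)
    have "(\<lambda>y. c * cos (v \<bullet> y + \<theta>) * (d * cos (w \<bullet> y + \<phi>)))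
        = (\<lambda>y. c * d / 2 * cos ((v - w) \<bullet> y + (\<theta> - \<phi>)) + c * d / 2 * cos ((v + w) \<bullet> y + (\<theta> + \<phi>)))"
    proof
      fix y
      have "cos (v \<bullet> y + \<theta>) * cos (w \<bullet> y + \<phi>)
          = (cos ((v - w) \<bullet> y + (\<theta> - \<phi>)) + cos ((v + w) \<bullet> y + (\<theta> + \<phi>))) / 2"
        unfolding cos_times_cos
        by (intro arg_cong2[where f = "\<lambda>a b. (cos a + cos b) / 2"])
           (simp_all add: inner_add_left inner_diff_left)
      then show "c * cos (v \<bullet> y + \<theta>) * (d * cos (w \<bullet> y + \<phi>))
          = c * d / 2 * cos ((v - w) \<bullet> y + (\<theta> - \<phi>)) + c * d / 2 * cos ((v + w) \<bullet> y + (\<theta> + \<phi>))"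
        by (simp add: field_simps)
    qed
    then show ?case by (simp only: trigonometric_polynomial.intros)
  next
    case (add f g)
    then show ?case by (simp add: distrib_left trigonometric_polynomial.add)
  qed
next
  case (add f g)
  then show ?case by (simp add: distrib_right trigonometric_polynomial.add)
qed

lemma trigonometric_polynomial_sum:
  assumes "\<And>i. i \<in> I \<Longrightarrow> trigonometric_polynomial (f i)"
  shows "trigonometric_polynomial (\<lambda>y. \<Sum>i\<in>I. f i y)"
  using assms
  by (induction I rule: infinite_finite_induct)
     (auto intro: trigonometric_polynomial_const trigonometric_polynomial.add)

lemma trigonometric_polynomial_sin: "trigonometric_polynomial (\<lambda>y. c * sin (v \<bullet> y))"
  using wave[of c v "- (pi / 2)"] by (simp only: cos_add) simp

text \<open>A replacement for the identity map that is built from sines and has bounded range, and that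
  converges to the identity as \<open>e\<close> tends to 0. Inserted into a polynomial it gives a trigonometric
  polynomial, and on its bounded range every continuous function is a uniform limit of
  polynomials.\<close>
definition sine_approximation :: "real \<Rightarrow> 'a::euclidean_space \<Rightarrow> 'a" where
  "sine_approximation e y = (\<Sum>b\<in>Basis. (sin (e * (y \<bullet> b)) / e) *\<^sub>R b)"

lemma trigonometric_polynomial_sine_approximation:
  assumes "real_polynomial_function q"
  shows "trigonometric_polynomial (\<lambda>y. q (sine_approximation e y))"
  using assms
proof (induction q rule: real_polynomial_function.induct)
  case (linear f)
  then interpret bounded_linear f .
  have "(\<lambda>y. f (sine_approximation e y)) = (\<lambda>y. \<Sum>b\<in>Basis. (f b / e) * sin ((e *\<^sub>R b) \<bullet> y))"
    by (auto simp: sine_approximation_def sum scaleR inner_commute intro!: sum.cong)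
  then show ?case
    by (simp only: trigonometric_polynomial_sum trigonometric_polynomial_sin)
qed (auto intro: trigonometric_polynomial_const trigonometric_polynomial.add
      trigonometric_polynomial_mult)

lemma sine_approximation_tendsto:
  "(\<lambda>n. sine_approximation (1 / real (Suc n)) y) \<longlonglongrightarrow> y"
proof -
  have "(\<lambda>n. sin (1 / real (Suc n) * r) / (1 / real (Suc n))) \<longlonglongrightarrow> r" for r :: real
  proof (cases "r = 0")
    case False
    have "((\<lambda>e. sin (e * r) / e) \<longlongrightarrow> r) (at 0)"
    proof -
      have "((\<lambda>e. sin (e * r)) has_real_derivative cos (0 * r) * r) (at 0)"
        by (auto intro!: derivative_eq_intros)
      then show ?thesis by (simp add: has_field_derivative_iff)
    qed
    moreover have "filterlim (\<lambda>n. 1 / real (Suc n)) (at 0) sequentially"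
      unfolding filterlim_at using LIMSEQ_Suc[OF lim_1_over_n] by simp
    ultimately show ?thesis by (rule filterlim_compose)
  qed simp
  then have "(\<lambda>n. sine_approximation (1 / real (Suc n)) y) \<longlonglongrightarrow> (\<Sum>b\<in>Basis. (y \<bullet> b) *\<^sub>R b)"
    unfolding sine_approximation_def by (intro tendsto_intros)
  then show ?thesis by (simp add: euclidean_representation)
qed

lemma sine_approximation_bounded: "bounded (range (sine_approximation e))"
proof (rule boundedI)
  fix z :: 'a assume "z \<in> range (sine_approximation e)"
  then obtain y where z: "z = sine_approximation e y" by auto
  have "norm z \<le> (\<Sum>b\<in>Basis. norm ((sin (e * (y \<bullet> b)) / e) *\<^sub>R (b :: 'a)))"
    unfolding z sine_approximation_def by (rule norm_sum)
  also have "\<dots> \<le> (\<Sum>b\<in>(Basis :: 'a set). 1 / \<bar>e\<bar>)"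
    by (intro sum_mono) (auto simp: abs_sin_le_one divide_right_mono)
  finally show "norm z \<le> (\<Sum>b\<in>(Basis :: 'a set). 1 / \<bar>e\<bar>)" .
qed

lemma continuous_sine_approximation: "continuous_on UNIV (sine_approximation e)"
  unfolding sine_approximation_def divide_inverse by (intro continuous_intros)

context
  fixes \<mu> \<nu> :: "'a::euclidean_space measure"
  assumes \<mu>: "finite_measure \<mu>" "sets \<mu> = sets borel"
    and \<nu>: "finite_measure \<nu>" "sets \<nu> = sets borel"
begin

interpretation \<mu>: finite_measure \<mu> by (rule \<mu>)
interpretation \<nu>: finite_measure \<nu> by (rule \<nu>)

lemma integrable_bounded_continuous:
  assumes "continuous_on UNIV F" "\<And>y. \<bar>F y\<bar> \<le> B"
  shows "integrable \<mu> F" "integrable \<nu> (F :: 'a \<Rightarrow> real)"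
proof -
  have [measurable]: "F \<in> borel_measurable borel"
    by (rule borel_measurable_continuous_onI) fact
  have "F \<in> borel_measurable \<mu>" "F \<in> borel_measurable \<nu>"
    using measurable_cong_sets[OF \<mu>(2) refl, of "borel :: real measure"]
      measurable_cong_sets[OF \<nu>(2) refl, of "borel :: real measure"]
    by simp_all
  then show "integrable \<mu> F" "integrable \<nu> F"
    using assms(2) by (auto intro!: \<mu>.integrable_const_bound[of _ B] \<nu>.integrable_const_bound[of _ B])
qed

text \<open>The indicator of a non-empty closed set \<open>C\<close> is the pointwise limit of the continuous functions
  \<open>max 0 (1 - n dist(\<cdot>, C))\<close>, and the closed sets form an intersection-stable generator.\<close>
lemma finite_measure_eqI_bounded_continuous:
  assumes eq: "\<And>(F :: 'a \<Rightarrow> real) B. continuous_on UNIV F \<Longrightarrow> (\<And>y. \<bar>F y\<bar> \<le> B) \<Longrightarrow> (\<integral>y. F y \<partial>\<mu>) = (\<integral>y. F y \<partial>\<nu>)"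
  shows "\<mu> = \<nu>"
proof -
  have closed_eq: "emeasure \<mu> C = emeasure \<nu> C" if C: "closed C" for C
  proof (cases "C = {}")
    case False
    define F where "F n y = max 0 (1 - real n * infdist y C)" for n y
    have F_bd: "\<bar>F n y\<bar> \<le> 1" for n y
      using infdist_nonneg[of y C] by (auto simp: F_def)
    have F_cont: "continuous_on UNIV (F n)" for n
      unfolding F_def by (intro continuous_intros)
    have lim: "(\<lambda>n. F n y) \<longlonglongrightarrow> indicator C y" for y
    proof (cases "y \<in> C")
      case True
      then show ?thesis by (simp add: F_def)
    next
      case y: False
      then have pos: "infdist y C > 0"
        using C False by (metis in_closed_iff_infdist_zero infdist_nonneg less_eq_real_def)
      obtain N :: nat where N: "1 / infdist y C < real N" using reals_Archimedean2 by blast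
      have "\<forall>\<^sub>F n in sequentially. F n y = 0"
        unfolding eventually_sequentially
      proof (intro exI allI impI)
        fix n assume "N \<le> n"
        then have "1 / infdist y C \<le> real n" using N by linarith
        then show "F n y = 0" using pos by (simp add: F_def field_simps)
      qed
      then show ?thesis using y by (simp add: tendsto_eventually)
    qed
    have "(\<lambda>n. \<integral>y. F n y \<partial>M) \<longlonglongrightarrow> measure M C"
      if "M = \<mu> \<or> M = \<nu>" for M
    proof -
      have sM: "sets M = sets borel" and fM: "finite_measure M" using that \<mu> \<nu> by auto
      interpret M: finite_measure M by (rule fM)
      have Cm: "C \<in> sets M" using C sM by simp
      have "(\<lambda>n. \<integral>y. F n y \<partial>M) \<longlonglongrightarrow> (\<integral>y. indicator C y \<partial>M)"
      proof (rule integral_dominated_convergence[where w = "\<lambda>_. 1"])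
        show "F n \<in> borel_measurable M" for n
          using integrable_bounded_continuous[OF F_cont F_bd] that by (auto dest: borel_measurable_integrable)
      qed (use F_bd lim Cm in auto)
      then show ?thesis using Cm by simp
    qed
    then have "(\<lambda>n. \<integral>y. F n y \<partial>\<mu>) \<longlonglongrightarrow> measure \<mu> C" "(\<lambda>n. \<integral>y. F n y \<partial>\<nu>) \<longlonglongrightarrow> measure \<nu> C"
      by auto
    then have "measure \<mu> C = measure \<nu> C"
      using eq[OF F_cont F_bd] LIMSEQ_unique by auto
    then show ?thesis by (simp add: \<mu>.emeasure_eq_measure \<nu>.emeasure_eq_measure)
  qed simp
  show ?thesis
  proof (rule measure_eqI_generator_eq[where E = "Collect closed" and \<Omega> = UNIV and A = "\<lambda>_. UNIV"])
    show "Int_stable (Collect closed :: 'a set set)" by (auto simp: Int_stable_def)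
    show "sets \<mu> = sigma_sets UNIV (Collect closed)" "sets \<nu> = sigma_sets UNIV (Collect closed)"
      using \<mu>(2) \<nu>(2) by (auto simp: borel_eq_closed)
  qed (use closed_eq \<mu>.emeasure_finite in auto)
qed

text \<open>Uniqueness of Fourier transforms of finite measures. Let \<open>S\<^sub>e\<close> be the sine approximation of the
  identity. For continuous bounded \<open>F\<close>, the Stone-Weierstrass theorem on the closure of the range
  of \<open>S\<^sub>e\<close> approximates \<open>F\<close> by polynomials \<open>q\<close>, so \<open>F \<circ> S\<^sub>e\<close> is on the whole space a uniform limit of
  trigonometric polynomials \<open>q \<circ> S\<^sub>e\<close> and has the same integral under both measures. As \<open>e\<close> tends
  to 0, \<open>F \<circ> S\<^sub>e\<close> converges to \<open>F\<close> boundedly.\<close>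
theorem finite_measure_eqI_cos:
  assumes cos_eq: "\<And>v \<theta>. (\<integral>y. cos (v \<bullet> y + \<theta>) \<partial>\<mu>) = (\<integral>y. cos (v \<bullet> y + \<theta>) \<partial>\<nu>)"
  shows "\<mu> = \<nu>"
proof (rule finite_measure_eqI_bounded_continuous)
  have trig: "integrable \<mu> f \<and> integrable \<nu> f \<and> (\<integral>y. f y \<partial>\<mu>) = (\<integral>y. f y \<partial>\<nu>)"
    if "trigonometric_polynomial f" for f
    using that
  proof induction
    case (wave c v \<theta>)
    have "continuous_on UNIV (\<lambda>y. cos (v \<bullet> y + \<theta>))" by (intro continuous_intros)
    then show ?case
      using integrable_bounded_continuous[of "\<lambda>y. cos (v \<bullet> y + \<theta>)" 1] cos_eq by simp
  qed auto
  fix F :: "'a \<Rightarrow> real" and B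
  assume F: "continuous_on UNIV F" and B: "\<And>y. \<bar>F y\<bar> \<le> B"
  have cont: "continuous_on UNIV (\<lambda>y. F (sine_approximation e y))" for e
    by (rule continuous_on_compose2[OF F continuous_sine_approximation]) simp
  have Feq: "(\<integral>y. F (sine_approximation e y) \<partial>\<mu>) = (\<integral>y. F (sine_approximation e y) \<partial>\<nu>)" for e
  proof -
    let ?F = "\<lambda>y. F (sine_approximation e y)"
    note intF = integrable_bounded_continuous[OF cont B]
    let ?m = "measure \<mu> (space \<mu>) + measure \<nu> (space \<nu>)"
    have approx: "\<bar>(\<integral>y. ?F y \<partial>\<mu>) - (\<integral>y. ?F y \<partial>\<nu>)\<bar> \<le> d * ?m" if d: "d > 0" for d
    proof -
      \<comment> \<open>The polynomial is close to \<open>F\<close> only on the closure of the range, which is all that the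
        composition with the sine approximation evaluates.\<close>
      have "compact (closure (range (sine_approximation e :: 'a \<Rightarrow> 'a)))"
        using sine_approximation_bounded by (simp add: compact_closure)
      then obtain q where q: "real_polynomial_function q"
        "\<And>x. x \<in> closure (range (sine_approximation e)) \<Longrightarrow> \<bar>F x - q x\<bar> < d"
        using Stone_Weierstrass_real_polynomial_function[OF _ continuous_on_subset[OF F subset_UNIV] d]
        by blast
      let ?q = "\<lambda>y. q (sine_approximation e y)"
      have qd: "\<bar>?F y - ?q y\<bar> \<le> d" for y
        using q(2)[of "sine_approximation e y"] subsetD[OF closure_subset rangeI] by (metis less_imp_le)
      have tq: "integrable \<mu> ?q" "integrable \<nu> ?q" "(\<integral>y. ?q y \<partial>\<mu>) = (\<integral>y. ?q y \<partial>\<nu>)"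
        using trig[OF trigonometric_polynomial_sine_approximation[OF q(1)]] by auto
      have bnd: "\<bar>(\<integral>y. ?F y \<partial>M) - (\<integral>y. ?q y \<partial>M)\<bar> \<le> d * measure M (space M)"
        if M: "finite_measure M" "integrable M ?F" "integrable M ?q" for M
      proof -
        interpret finite_measure M by (rule M)
        have "\<bar>(\<integral>y. ?F y \<partial>M) - (\<integral>y. ?q y \<partial>M)\<bar> = \<bar>\<integral>y. ?F y - ?q y \<partial>M\<bar>" using M by simp
        also have "\<dots> \<le> (\<integral>y. \<bar>?F y - ?q y\<bar> \<partial>M)" by (rule integral_abs_bound)
        also have "\<dots> \<le> (\<integral>y. d \<partial>M)" using M qd by (intro integral_mono) auto
        finally show ?thesis by (simp add: mult.commute)
      qed
      show ?thesis
        using bnd[OF \<mu>(1) intF(1) tq(1)] bnd[OF \<nu>(1) intF(2) tq(2)] tq(3)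
        by (simp add: distrib_left)
    qed
    have "\<bar>(\<integral>y. ?F y \<partial>\<mu>) - (\<integral>y. ?F y \<partial>\<nu>)\<bar> \<le> 0"
      by (rule nonpos_if_le_small_multiples[OF approx]) (simp_all add: add_nonneg_nonneg)
    then show ?thesis by linarith
  qed
  have "(\<lambda>n. \<integral>y. F (sine_approximation (1 / real (Suc n)) y) \<partial>M) \<longlonglongrightarrow> (\<integral>y. F y \<partial>M)"
    if M: "M = \<mu> \<or> M = \<nu>" for M
  proof (rule integral_dominated_convergence[where w = "\<lambda>_. B"])
    interpret finite_measure M using M \<mu> \<nu> by auto
    show "F \<in> borel_measurable M"
      using M integrable_bounded_continuous[OF F B, THEN borel_measurable_integrable] by blast
    show "(\<lambda>y. F (sine_approximation (1 / real (Suc n)) y)) \<in> borel_measurable M" for n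
      using M integrable_bounded_continuous[OF cont B, THEN borel_measurable_integrable] by blast
    show "integrable M (\<lambda>_. B)" by simp
    show "AE y in M. (\<lambda>n. F (sine_approximation (1 / real (Suc n)) y)) \<longlonglongrightarrow> F y"
      using continuous_on_tendsto_compose[OF F sine_approximation_tendsto] by (intro AE_I2) simp
  qed (use B in auto)
  then have "(\<lambda>n. \<integral>y. F (sine_approximation (1 / real (Suc n)) y) \<partial>\<mu>) \<longlonglongrightarrow> (\<integral>y. F y \<partial>\<mu>)"
    "(\<lambda>n. \<integral>y. F (sine_approximation (1 / real (Suc n)) y) \<partial>\<nu>) \<longlonglongrightarrow> (\<integral>y. F y \<partial>\<nu>)"
    by auto
  then show "(\<integral>y. F y \<partial>\<mu>) = (\<integral>y. F y \<partial>\<nu>)" unfolding Feq by (rule LIMSEQ_unique)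
qed

end

section \<open>Markov processes and germ events\<close>

text \<open>The Markov property under one fixed law, on an arbitrary state space. It is kept apart from
  path space so that the argument about germs shows which regularity it uses.\<close>
locale markov_wrt_filtration = prob_space Q
  for Q :: "'w measure"
    and F :: "real \<Rightarrow> 'w measure"
    and E :: "'e measure"
    and X :: "real \<Rightarrow> 'w \<Rightarrow> 'e"
    and p :: "real \<Rightarrow> 'e \<Rightarrow> 'e measure" +
  assumes subalgebra_F: "0 \<le> s \<Longrightarrow> subalgebra Q (F s)"
    and F_mono: "0 \<le> s \<Longrightarrow> s \<le> t \<Longrightarrow> sets (F s) \<subseteq> sets (F t)"
    and adapted: "0 \<le> s \<Longrightarrow> X s \<in> F s \<rightarrow>\<^sub>M E"
    and kernel: "0 \<le> t \<Longrightarrow> p t \<in> E \<rightarrow>\<^sub>M subprob_algebra E"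
    and markov: "0 \<le> s \<Longrightarrow> 0 \<le> t \<Longrightarrow> f \<in> bounded_measurable E \<Longrightarrow>
      AE \<omega> in Q. real_cond_exp Q (F s) (\<lambda>\<omega>. f (X (t + s) \<omega>)) \<omega> = (\<integral>y. f y \<partial>p t (X s \<omega>))"
begin

lemma finite_measure_subalgebra_F: "0 \<le> s \<Longrightarrow> finite_measure_subalgebra Q (F s)"
  by unfold_locales (rule subalgebra_F)

lemma F_subalgebra: "0 \<le> s \<Longrightarrow> s \<le> t \<Longrightarrow> subalgebra (F t) (F s)"
  using subalgebra_F[of s] subalgebra_F[of t] F_mono[of s t] by (auto simp: subalgebra_def)

lemma adapted_le: "0 \<le> s \<Longrightarrow> s \<le> t \<Longrightarrow> X s \<in> F t \<rightarrow>\<^sub>M E"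
  by (rule measurable_from_subalg[OF F_subalgebra adapted])

lemma adapted_Q: "0 \<le> s \<Longrightarrow> X s \<in> Q \<rightarrow>\<^sub>M E"
  by (rule measurable_from_subalg[OF subalgebra_F adapted])

lemma bounded_measurable_kernel:
  assumes t: "0 \<le> t" and f: "f \<in> bounded_measurable E"
  shows "(\<lambda>y. \<integral>z. f z \<partial>p t y) \<in> bounded_measurable E"
proof -
  obtain B where B: "B \<ge> 0" "\<And>x. x \<in> space E \<Longrightarrow> \<bar>f x\<bar> \<le> B"
    using bounded_measurableE[OF f] by metis
  note [measurable] = bounded_measurable_measurable[OF f]
  show ?thesis
  proof (rule bounded_measurableI[of _ _ B])
    show "(\<lambda>y. \<integral>z. f z \<partial>p t y) \<in> borel_measurable E"
      by (rule measurable_compose[OF kernel[OF t] integral_measurable_subprob_algebra]) measurable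
    fix y assume y: "y \<in> space E"
    then have "p t y \<in> space (subprob_algebra E)" by (rule measurable_space[OF kernel[OF t]])
    then have sub: "subprob_space (p t y)" and sets: "sets (p t y) = sets E"
      by (auto simp: space_subprob_algebra)
    interpret subprob_space "p t y" by (rule sub)
    have fm: "f \<in> bounded_measurable (p t y)"
      using f measurable_cong_sets[OF sets refl, of "borel :: real measure"] sets_eq_imp_space_eq[OF sets]
      by (auto simp: bounded_measurable_def)
    have "\<bar>\<integral>z. f z \<partial>p t y\<bar> \<le> (\<integral>z. \<bar>f z\<bar> \<partial>p t y)" by (rule integral_abs_bound)
    also have "\<dots> \<le> (\<integral>z. B \<partial>p t y)"
      using integrable_bounded_measurable[OF fm] B sets_eq_imp_space_eq[OF sets]
      by (intro integral_mono) auto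
    also have "\<dots> \<le> B"
      using B(1) subprob_measure_le_1 by (simp add: mult_left_le_one_le)
    finally show "\<bar>\<integral>z. f z \<partial>p t y\<bar> \<le> B" .
  qed
qed

lemma markov_integral:
  assumes st: "0 \<le> s" "s \<le> t" and f: "f \<in> bounded_measurable E"
    and W: "integrable Q W" "W \<in> borel_measurable (F s)"
  shows "(\<integral>\<omega>. W \<omega> * f (X t \<omega>) \<partial>Q) = (\<integral>\<omega>. W \<omega> * (\<integral>y. f y \<partial>p (t - s) (X s \<omega>)) \<partial>Q)"
proof -
  interpret sub: finite_measure_subalgebra Q "F s"
    using st by (intro finite_measure_subalgebra_F)
  have fX: "(\<lambda>\<omega>. f (X t \<omega>)) \<in> bounded_measurable Q"
    using st by (intro bounded_measurable_comp[OF f] adapted_Q) auto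
  have "(\<integral>\<omega>. W \<omega> * f (X t \<omega>) \<partial>Q)
      = (\<integral>\<omega>. W \<omega> * real_cond_exp Q (F s) (\<lambda>\<omega>. f (X t \<omega>)) \<omega> \<partial>Q)"
    by (rule sub.real_cond_exp_intg(2)[symmetric])
       (use W fX in \<open>auto intro: integrable_mult_bounded_measurable bounded_measurable_measurable\<close>)
  also have "\<dots> = (\<integral>\<omega>. W \<omega> * (\<integral>y. f y \<partial>p (t - s) (X s \<omega>)) \<partial>Q)"
  proof (rule integral_cong_AE)
    have "(\<lambda>\<omega>. \<integral>y. f y \<partial>p (t - s) (X s \<omega>)) \<in> borel_measurable Q"
      using st by (intro bounded_measurable_measurable
        bounded_measurable_comp[OF bounded_measurable_kernel adapted_Q] f) auto
    then show "(\<lambda>\<omega>. W \<omega> * (\<integral>y. f y \<partial>p (t - s) (X s \<omega>))) \<in> borel_measurable Q"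
      using W by measurable
    show "AE \<omega> in Q. W \<omega> * real_cond_exp Q (F s) (\<lambda>\<omega>. f (X t \<omega>)) \<omega>
        = W \<omega> * (\<integral>y. f y \<partial>p (t - s) (X s \<omega>))"
      using markov[of s "t - s" f] st f by auto
  qed (use W in measurable)
  finally show ?thesis .
qed

definition right_regular :: "real \<Rightarrow> ('e \<Rightarrow> real) \<Rightarrow> bool" where
  "right_regular t f \<longleftrightarrow>
     (\<forall>\<omega>\<in>space Q. ((\<lambda>s. f (X s \<omega>)) \<longlongrightarrow> f (X t \<omega>)) (at_right t))"

text \<open>The functions that are measurable with respect to the germ \<open>\<sigma>\<close>-algebra at \<open>t\<close>, the
  intersection of the \<open>\<F>\<^sub>s\<close> over \<open>s > t\<close>, and orthogonal to \<open>\<F>\<^sub>t\<close>. The filtration is right-continuous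
  at \<open>t\<close>, up to null sets, if and only if all of them vanish almost surely.\<close>
definition germ_orthogonal :: "real \<Rightarrow> ('w \<Rightarrow> real) \<Rightarrow> bool" where
  "germ_orthogonal t Z \<longleftrightarrow> integrable Q Z \<and> (\<forall>s>t. Z \<in> borel_measurable (F s)) \<and>
     (\<forall>W\<in>bounded_measurable (F t). (\<integral>\<omega>. Z \<omega> * W \<omega> \<partial>Q) = 0)"

lemma germ_orthogonal_mult:
  assumes t: "0 \<le> t" and Z: "germ_orthogonal t Z" and W: "W \<in> bounded_measurable (F t)"
  shows "germ_orthogonal t (\<lambda>\<omega>. Z \<omega> * W \<omega>)"
  unfolding germ_orthogonal_def
proof (intro conjI allI impI ballI)
  show "integrable Q (\<lambda>\<omega>. Z \<omega> * W \<omega>)"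
    using Z bounded_measurable_subalgebra[OF W subalgebra_F[OF t]]
    by (intro integrable_mult_bounded_measurable) (auto simp: germ_orthogonal_def)
  show "(\<lambda>\<omega>. Z \<omega> * W \<omega>) \<in> borel_measurable (F s)" if "t < s" for s
    using Z that
      bounded_measurable_measurable[OF bounded_measurable_subalgebra[OF W F_subalgebra[OF t]], of s]
    by (auto simp: germ_orthogonal_def)
  show "(\<integral>\<omega>. Z \<omega> * W \<omega> * V \<omega> \<partial>Q) = 0" if "V \<in> bounded_measurable (F t)" for V
    using Z bounded_measurable_mult[OF W that] by (simp add: germ_orthogonal_def mult.assoc)
qed

lemma integral_right_regular:
  assumes t: "0 \<le> t" and Z: "integrable Q Z" and f: "f \<in> bounded_measurable E"
    and reg: "right_regular t f"
  shows "(\<lambda>n. \<integral>\<omega>. Z \<omega> * f (X (t + 1 / real (Suc n)) \<omega>) \<partial>Q) \<longlonglongrightarrow> (\<integral>\<omega>. Z \<omega> * f (X t \<omega>) \<partial>Q)"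
proof -
  obtain B where B: "B \<ge> 0" "\<And>x. x \<in> space E \<Longrightarrow> \<bar>f x\<bar> \<le> B"
    using bounded_measurableE[OF f] by metis
  have fX: "(\<lambda>\<omega>. f (X s \<omega>)) \<in> borel_measurable Q" if "0 \<le> s" for s
    using bounded_measurable_measurable[OF bounded_measurable_comp[OF f adapted_Q[OF that]]] .
  show ?thesis
  proof (rule integral_dominated_convergence[where w = "\<lambda>\<omega>. \<bar>Z \<omega>\<bar> * B"])
    have "0 \<le> t + 1 / real (Suc n)" for n using t by simp
    then show "(\<lambda>\<omega>. Z \<omega> * f (X (t + 1 / real (Suc n)) \<omega>)) \<in> borel_measurable Q" for n
      using fX Z by measurable
    show "(\<lambda>\<omega>. Z \<omega> * f (X t \<omega>)) \<in> borel_measurable Q"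
      using fX[OF t] Z by measurable
    show "integrable Q (\<lambda>\<omega>. \<bar>Z \<omega>\<bar> * B)" using Z by simp
    show "AE \<omega> in Q. (\<lambda>n. Z \<omega> * f (X (t + 1 / real (Suc n)) \<omega>)) \<longlonglongrightarrow> Z \<omega> * f (X t \<omega>)"
    proof (rule AE_I2)
      fix \<omega> assume "\<omega> \<in> space Q"
      then have "((\<lambda>s. f (X s \<omega>)) \<longlongrightarrow> f (X t \<omega>)) (at_right t)"
        using reg by (simp add: right_regular_def)
      moreover have "filterlim (\<lambda>n. t + 1 / real (Suc n)) (at_right t) sequentially"
        unfolding filterlim_at using tendsto_add[OF tendsto_const LIMSEQ_Suc[OF lim_1_over_n], of t]
        by auto
      ultimately have "(\<lambda>n. f (X (t + 1 / real (Suc n)) \<omega>)) \<longlonglongrightarrow> f (X t \<omega>)"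
        by (rule filterlim_compose)
      then show "(\<lambda>n. Z \<omega> * f (X (t + 1 / real (Suc n)) \<omega>)) \<longlonglongrightarrow> Z \<omega> * f (X t \<omega>)"
        by (rule tendsto_mult_left)
    qed
    show "AE \<omega> in Q. norm (Z \<omega> * f (X (t + 1 / real (Suc n)) \<omega>)) \<le> \<bar>Z \<omega>\<bar> * B" for n
    proof (rule AE_I2)
      fix \<omega> assume "\<omega> \<in> space Q"
      then have "X (t + 1 / real (Suc n)) \<omega> \<in> space E"
        using measurable_space[OF adapted_Q] t by simp
      then show "norm (Z \<omega> * f (X (t + 1 / real (Suc n)) \<omega>)) \<le> \<bar>Z \<omega>\<bar> * B"
        unfolding real_norm_def abs_mult using B by (intro mult_left_mono) auto
    qed
  qed
qed

text \<open>With \<open>h\<close> the image of \<open>g\<close> under the kernel of duration \<open>b - t\<close>, the Markov property is applied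
  between the times \<open>t + 1/(n+1)\<close> and \<open>b + 1/(n+1)\<close>. Their difference is always \<open>b - t\<close>, so as \<open>n\<close>
  grows only the paths move, and the kernel stays the same.\<close>
lemma germ_orthogonal_single_time:
  assumes t: "0 \<le> t" "t \<le> b" and Z: "germ_orthogonal t Z"
    and C: "measure_determining E C" "C \<subseteq> bounded_measurable E"
    and reg: "\<And>f s. f \<in> C \<Longrightarrow> 0 \<le> s \<Longrightarrow> right_regular s f"
      "\<And>f r s. f \<in> C \<Longrightarrow> 0 \<le> s \<Longrightarrow> 0 \<le> r \<Longrightarrow> right_regular s (\<lambda>y. \<integral>z. f z \<partial>p r y)"
    and f: "f \<in> bounded_measurable E"
  shows "(\<integral>\<omega>. Z \<omega> * f (X b \<omega>) \<partial>Q) = 0"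
proof (rule determining_orthogonal[OF C _ _ _ f])
  have intZ: "integrable Q Z" and ZF: "\<And>s. t < s \<Longrightarrow> Z \<in> borel_measurable (F s)"
    and orth: "\<And>W. W \<in> bounded_measurable (F t) \<Longrightarrow> (\<integral>\<omega>. Z \<omega> * W \<omega> \<partial>Q) = 0"
    using Z by (auto simp: germ_orthogonal_def)
  show "integrable Q Z" by (rule intZ)
  show "X b \<in> Q \<rightarrow>\<^sub>M E" using t by (intro adapted_Q) simp
  fix g assume g: "g \<in> C"
  define h where "h = (\<lambda>y. \<integral>z. g z \<partial>p (b - t) y)"
  have gm: "g \<in> bounded_measurable E" using g C(2) by auto
  then have hm: "h \<in> bounded_measurable E"
    unfolding h_def using t by (intro bounded_measurable_kernel) auto
  have "(\<integral>\<omega>. Z \<omega> * g (X (b + 1 / real (Suc n)) \<omega>) \<partial>Q) = (\<integral>\<omega>. Z \<omega> * h (X (t + 1 / real (Suc n)) \<omega>) \<partial>Q)"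
    for n
    using markov_integral[of "t + 1 / real (Suc n)" "b + 1 / real (Suc n)", OF _ _ gm intZ ZF] t
    by (simp add: h_def)
  moreover have "(\<lambda>n. \<integral>\<omega>. Z \<omega> * g (X (b + 1 / real (Suc n)) \<omega>) \<partial>Q) \<longlonglongrightarrow> (\<integral>\<omega>. Z \<omega> * g (X b \<omega>) \<partial>Q)"
    using t g by (intro integral_right_regular intZ gm reg) auto
  moreover have "(\<lambda>n. \<integral>\<omega>. Z \<omega> * h (X (t + 1 / real (Suc n)) \<omega>) \<partial>Q) \<longlonglongrightarrow> (\<integral>\<omega>. Z \<omega> * h (X t \<omega>) \<partial>Q)"
    using t g reg(2)[of g t "b - t"]
    by (intro integral_right_regular intZ hm) (auto simp: h_def)
  ultimately have "(\<integral>\<omega>. Z \<omega> * g (X b \<omega>) \<partial>Q) = (\<integral>\<omega>. Z \<omega> * h (X t \<omega>) \<partial>Q)"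
    using LIMSEQ_unique by auto
  also have "\<dots> = 0"
    using t by (intro orth bounded_measurable_comp[OF hm adapted]) auto
  finally show "(\<integral>\<omega>. Z \<omega> * g (X b \<omega>) \<partial>Q) = 0" .
qed

text \<open>Induction on the times in increasing order, adding a largest time \<open>b\<close>. If \<open>b \<le> t\<close>, everything
  is known at \<open>t\<close>. If \<open>b\<close> is the only time after \<open>t\<close>, the other factors can be absorbed into \<open>Z\<close>,
  which leaves a single time. Otherwise the Markov property at the preceding time \<open>a > t\<close>, where \<open>Z\<close>
  is measurable, replaces the factor at \<open>b\<close> by an additional factor at \<open>a\<close>.\<close>
lemma germ_orthogonal_finite_times:
  assumes t: "0 \<le> t" and Z: "germ_orthogonal t Z"
    and C: "measure_determining E C" "C \<subseteq> bounded_measurable E"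
    and reg: "\<And>f s. f \<in> C \<Longrightarrow> 0 \<le> s \<Longrightarrow> right_regular s f"
      "\<And>f r s. f \<in> C \<Longrightarrow> 0 \<le> s \<Longrightarrow> 0 \<le> r \<Longrightarrow> right_regular s (\<lambda>y. \<integral>z. f z \<partial>p r y)"
    and I: "finite I" "I \<subseteq> {0..}" and f: "\<And>s. s \<in> I \<Longrightarrow> f s \<in> bounded_measurable E"
  shows "(\<integral>\<omega>. Z \<omega> * (\<Prod>s\<in>I. f s (X s \<omega>)) \<partial>Q) = 0"
  using I f
proof (induction I arbitrary: f rule: finite_linorder_max_induct)
  case empty
  show ?case
    using Z bounded_measurable_const[of 1 "F t"] by (auto simp: germ_orthogonal_def)
next
  case (insert b A)
  have b: "0 \<le> b" "b \<notin> A" using insert by auto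
  have prod: "(\<Prod>s\<in>insert b A. f s (X s \<omega>)) = (\<Prod>s\<in>A. f s (X s \<omega>)) * f b (X b \<omega>)" for \<omega>
    using b insert.hyps(1) by (simp add: mult.commute)
  have past: "(\<lambda>\<omega>. \<Prod>s\<in>A'. f s (X s \<omega>)) \<in> bounded_measurable (F c)"
    if "A' \<subseteq> insert b A" "\<And>s. s \<in> A' \<Longrightarrow> s \<le> c" for A' c
    using that insert.prems
    by (intro bounded_measurable_prod bounded_measurable_comp[OF _ adapted_le]) auto
  consider "b \<le> t" | "t < b" "\<forall>a\<in>A. a \<le> t" | "t < b" "\<exists>a\<in>A. t < a" by force
  then show ?case
  proof cases
    case 1
    then have "(\<lambda>\<omega>. \<Prod>s\<in>insert b A. f s (X s \<omega>)) \<in> bounded_measurable (F t)"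
      using insert.hyps(2) by (intro past) force+
    then show ?thesis using Z by (simp add: germ_orthogonal_def)
  next
    case 2
    then have "(\<lambda>\<omega>. \<Prod>s\<in>A. f s (X s \<omega>)) \<in> bounded_measurable (F t)" by (intro past) auto
    then have "germ_orthogonal t (\<lambda>\<omega>. Z \<omega> * (\<Prod>s\<in>A. f s (X s \<omega>)))"
      by (rule germ_orthogonal_mult[OF t Z])
    from germ_orthogonal_single_time[OF t _ this C reg insert.prems(2)] 2
    show ?thesis unfolding prod mult.assoc by simp
  next
    case 3
    define a where "a = Max A"
    have a: "a \<in> A" "t < a" "\<And>s. s \<in> A \<Longrightarrow> s \<le> a" "0 \<le> a" "a < b"
    proof -
      have A: "A \<noteq> {}" using 3 by auto
      show "a \<in> A" unfolding a_def by (rule Max_in[OF insert.hyps(1) A])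
      show "t < a" unfolding a_def using 3(2) by (simp add: Max_gr_iff[OF insert.hyps(1) A])
      show "s \<le> a" if "s \<in> A" for s unfolding a_def by (rule Max_ge[OF insert.hyps(1) that])
      show "0 \<le> a" "a < b" using \<open>a \<in> A\<close> insert.hyps(2) insert.prems(1) by auto
    qed
    define h where "h = (\<lambda>y. \<integral>z. f b z \<partial>p (b - a) y)"
    have hm: "h \<in> bounded_measurable E"
      unfolding h_def using a insert.prems by (intro bounded_measurable_kernel) auto
    have Pm: "(\<lambda>\<omega>. \<Prod>s\<in>A. f s (X s \<omega>)) \<in> bounded_measurable (F a)"
      using a by (intro past) auto
    have ZP: "integrable Q (\<lambda>\<omega>. Z \<omega> * (\<Prod>s\<in>A. f s (X s \<omega>)))"
      using Z bounded_measurable_subalgebra[OF Pm subalgebra_F[OF a(4)]]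
      by (intro integrable_mult_bounded_measurable) (auto simp: germ_orthogonal_def)
    have ZPm: "(\<lambda>\<omega>. Z \<omega> * (\<Prod>s\<in>A. f s (X s \<omega>))) \<in> borel_measurable (F a)"
      using Z a(2) bounded_measurable_measurable[OF Pm] by (auto simp: germ_orthogonal_def)
    have "(\<integral>\<omega>. Z \<omega> * (\<Prod>s\<in>insert b A. f s (X s \<omega>)) \<partial>Q)
        = (\<integral>\<omega>. (Z \<omega> * (\<Prod>s\<in>A. f s (X s \<omega>))) * f b (X b \<omega>) \<partial>Q)"
      unfolding prod by (simp only: mult.assoc)
    also have "\<dots> = (\<integral>\<omega>. (Z \<omega> * (\<Prod>s\<in>A. f s (X s \<omega>))) * h (X a \<omega>) \<partial>Q)"
      unfolding h_def using a insert.prems by (intro markov_integral ZP ZPm) auto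
    also have "\<dots> = (\<integral>\<omega>. Z \<omega> * (\<Prod>s\<in>A. (f(a := \<lambda>y. f a y * h y)) s (X s \<omega>)) \<partial>Q)"
      using a(1) insert.hyps(1) by (simp add: prod.remove[of A a] ac_simps)
    also have "\<dots> = 0"
      using insert.prems a(1) hm by (intro insert.IH) (auto intro: bounded_measurable_mult)
    finally show ?thesis .
  qed
qed

text \<open>Orthogonality is the defining property of the conditional expectation, and the residual stays
  measurable at all later times because the filtration increases.\<close>
lemma germ_orthogonal_residual:
  assumes t: "0 \<le> t" and A: "\<And>s. t < s \<Longrightarrow> A \<in> sets (F s)"
  shows "germ_orthogonal t (\<lambda>\<omega>. indicator A \<omega> - real_cond_exp Q (F t) (indicator A) \<omega>)"
  unfolding germ_orthogonal_def
proof (intro conjI allI impI ballI)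
  interpret sub: finite_measure_subalgebra Q "F t"
    using t by (rule finite_measure_subalgebra_F)
  have AQ: "A \<in> sets Q"
    using A[of "t + 1"] subalgebra_F[of "t + 1"] t by (auto simp: subalgebra_def)
  have intA: "integrable Q (indicator A :: _ \<Rightarrow> real)"
    using AQ by (intro integrable_bounded_measurable bounded_measurable_indicator)
  show "integrable Q (\<lambda>\<omega>. indicator A \<omega> - real_cond_exp Q (F t) (indicator A) \<omega>)"
    by (intro Bochner_Integration.integrable_diff intA sub.real_cond_exp_int)
  show "(\<lambda>\<omega>. indicator A \<omega> - real_cond_exp Q (F t) (indicator A) \<omega>) \<in> borel_measurable (F s)"
    if "t < s" for s
    using A[OF that] measurable_from_subalg[OF F_subalgebra[OF t, of s] borel_measurable_cond_exp] that
    by (intro borel_measurable_diff) auto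
  fix W assume W: "W \<in> bounded_measurable (F t)"
  have WA: "integrable Q (\<lambda>\<omega>. W \<omega> * indicator A \<omega>)"
    using integrable_mult_bounded_measurable[OF intA bounded_measurable_subalgebra[OF W subalgebra_F[OF t]]]
    by (simp add: mult.commute)
  note cond = sub.real_cond_exp_intg[OF WA bounded_measurable_measurable[OF W] borel_measurable_indicator[OF AQ]]
  have "(\<integral>\<omega>. (indicator A \<omega> - real_cond_exp Q (F t) (indicator A) \<omega>) * W \<omega> \<partial>Q)
      = (\<integral>\<omega>. W \<omega> * indicator A \<omega> - W \<omega> * real_cond_exp Q (F t) (indicator A) \<omega> \<partial>Q)"
    by (simp add: algebra_simps)
  also have "\<dots> = 0"
    by (subst Bochner_Integration.integral_diff[OF WA cond(1)]) (simp add: cond(2))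
  finally show "(\<integral>\<omega>. (indicator A \<omega> - real_cond_exp Q (F t) (indicator A) \<omega>) * W \<omega> \<partial>Q) = 0" .
qed

text \<open>An event \<open>A\<close> of the germ \<open>\<sigma>\<close>-algebra equals its conditional probability given \<open>\<F>\<^sub>t\<close> almost
  surely, hence differs by a null set from the event of \<open>\<F>\<^sub>t\<close> that this probability is 1.\<close>
theorem right_continuous_if_germ_orthogonal_zero:
  assumes t: "0 \<le> t" and null: "null_sets Q \<subseteq> sets (F t)"
    and zero: "\<And>Z. germ_orthogonal t Z \<Longrightarrow> AE \<omega> in Q. Z \<omega> = 0"
  shows "(\<Inter>s\<in>{t<..}. sets (F s)) = sets (F t)"
proof
  show "sets (F t) \<subseteq> (\<Inter>s\<in>{t<..}. sets (F s))" by (intro INT_greatest F_mono t) simp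
  show "(\<Inter>s\<in>{t<..}. sets (F s)) \<subseteq> sets (F t)"
  proof
    fix A assume "A \<in> (\<Inter>s\<in>{t<..}. sets (F s))"
    then have A: "\<And>s. t < s \<Longrightarrow> A \<in> sets (F s)" by auto
    have AQ: "A \<in> sets Q"
      using A[of "t + 1"] subalgebra_F[of "t + 1"] t by (auto simp: subalgebra_def)
    define g where "g = real_cond_exp Q (F t) (indicator A)"
    define A' where "A' = {\<omega>\<in>space (F t). g \<omega> = 1}"
    have A': "A' \<in> sets (F t)" unfolding A'_def g_def by measurable
    then have A'Q: "A' \<in> sets Q" using subalgebra_F[OF t] by (auto simp: subalgebra_def)
    have "AE \<omega> in Q. indicator A \<omega> - g \<omega> = 0"
      unfolding g_def by (rule zero[OF germ_orthogonal_residual[OF t A]])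
    then have ae: "AE \<omega> in Q. \<omega> \<in> A \<longleftrightarrow> \<omega> \<in> A'"
    proof (rule AE_mp, intro AE_I2 impI)
      fix \<omega> assume "\<omega> \<in> space Q" "indicator A \<omega> - g \<omega> = 0"
      then show "\<omega> \<in> A \<longleftrightarrow> \<omega> \<in> A'"
        using subalgebra_F[OF t] by (cases "\<omega> \<in> A") (auto simp: A'_def subalgebra_def)
    qed
    have "A - A' \<in> null_sets Q" "A' - A \<in> null_sets Q"
      using ae AQ A'Q by (auto simp: AE_iff_null_sets elim: eventually_mono)
    then have "A' \<union> (A - A') - (A' - A) \<in> sets (F t)" using A' null by blast
    moreover have "A' \<union> (A - A') - (A' - A) = A" by auto
    ultimately show "A \<in> sets (F t)" by simp
  qed
qed

end

section \<open>State space with cemetery and the path space\<close>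

lemma cemetery_generator_subset:
  "insert {None} ((`) Some ` sets (restrict_space borel D)) \<subseteq> Pow (insert None (Some ` D))"
  by (auto simp: sets_restrict_space)

lemma sets_cemetery_measurable:
  "sets (cemetery_measurable D) =
     sigma_sets (insert None (Some ` D)) (insert {None} ((`) Some ` sets (restrict_space borel D)))"
  unfolding cemetery_measurable_def
  by (rule sets_measure_of[OF cemetery_generator_subset])

lemma space_cemetery_measurable: "space (cemetery_measurable D) = insert None (Some ` D)"
  unfolding cemetery_measurable_def
  by (rule space_measure_of[OF cemetery_generator_subset])

lemma None_in_sets_cemetery: "{None} \<in> sets (cemetery_measurable D)"
  by (auto simp: sets_cemetery_measurable)

lemma Some_image_in_sets_cemetery:
  "B \<in> sets (restrict_space borel D) \<Longrightarrow> Some ` B \<in> sets (cemetery_measurable D)"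
  by (auto simp: sets_cemetery_measurable)

lemma Some_state_in_sets_cemetery: "Some ` D \<in> sets (cemetery_measurable D)"
  using Some_image_in_sets_cemetery[OF sets.top[of "restrict_space borel D"]]
  by (simp add: space_restrict_space)

lemma zero_ext_measurable:
  assumes f: "f \<in> borel_measurable borel"
  shows "zero_ext f \<in> borel_measurable (cemetery_measurable D)"
proof (rule measurableI)
  fix B assume "B \<in> sets (borel :: 'b measure)"
  then have "f -` B \<in> sets borel" using measurable_sets[OF f] by simp
  then have "Some ` (D \<inter> f -` B) \<in> sets (cemetery_measurable D)"
    by (intro Some_image_in_sets_cemetery) (auto simp: sets_restrict_space)
  moreover have "zero_ext f -` B \<inter> space (cemetery_measurable D)
      = Some ` (D \<inter> f -` B) \<union> (if 0 \<in> B then {None} else {})"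
    by (auto simp: space_cemetery_measurable split: option.splits)
  moreover have "(if 0 \<in> B then {None} else {}) \<in> sets (cemetery_measurable D)"
    by (simp add: None_in_sets_cemetery)
  ultimately show "zero_ext f -` B \<inter> space (cemetery_measurable D) \<in> sets (cemetery_measurable D)"
    by (simp only: sets.Un)
qed simp

text \<open>Waves on \<open>D\<close> do not see the mass of the cemetery; the constant, which is 1 also there, does.\<close>
definition state_waves :: "('a::euclidean_space option \<Rightarrow> real) set" where
  "state_waves = insert (\<lambda>_. 1) {zero_ext (\<lambda>y. cos (v \<bullet> y + \<theta>)) |v \<theta>. True}"

lemma state_waves_bounded_measurable:
  "state_waves \<subseteq> bounded_measurable (cemetery_measurable D)"
proof
  fix f :: "'a option \<Rightarrow> real" assume "f \<in> state_waves"
  then consider "f = (\<lambda>_. 1)" | v \<theta> where "f = zero_ext (\<lambda>y. cos (v \<bullet> y + \<theta>))"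
    by (auto simp: state_waves_def)
  then show "f \<in> bounded_measurable (cemetery_measurable D)"
  proof cases
    case 1
    then show ?thesis by (simp add: bounded_measurable_const)
  next
    case 2
    show ?thesis unfolding 2
    proof (rule bounded_measurableI[of _ _ 1])
      show "zero_ext (\<lambda>y. cos (v \<bullet> y + \<theta>)) \<in> borel_measurable (cemetery_measurable D)"
        by (rule zero_ext_measurable) measurable
      show "\<bar>zero_ext (\<lambda>y. cos (v \<bullet> y + \<theta>)) \<xi>\<bar> \<le> 1" for \<xi> by (cases \<xi>) auto
    qed
  qed
qed

text \<open>The part of a measure on \<open>D\<close> is transported to the whole Euclidean space, where the waves
  determine it; the mass of the cemetery is then the rest of the total mass.\<close>
lemma measure_determining_state_waves:
  fixes D :: "'a::euclidean_space set"
  shows "measure_determining (cemetery_measurable D) state_waves"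
  unfolding measure_determining_def
proof (intro allI impI)
  let ?E = "cemetery_measurable D" and ?\<R> = "restrict_space borel D"
  fix \<mu> \<nu> :: "'a option measure"
  assume fin: "finite_measure \<mu>" "finite_measure \<nu>"
    and sets: "sets \<mu> = sets ?E" "sets \<nu> = sets ?E"
    and eq: "\<forall>f\<in>state_waves. (\<integral>y. f y \<partial>\<mu>) = (\<integral>y. f y \<partial>\<nu>)"
  interpret \<mu>: finite_measure \<mu> by fact
  interpret \<nu>: finite_measure \<nu> by fact
  define Y :: "'a option \<Rightarrow> 'a" where "Y = zero_ext (\<lambda>y. y)"
  define live where "live M = distr (density M (indicator (Some ` D))) borel Y" for M
  have Y_E: "Y \<in> borel_measurable ?E"
    unfolding Y_def by (rule zero_ext_measurable) simp
  have Y: "Y \<in> borel_measurable M" if "sets M = sets ?E" for M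
    using Y_E measurable_cong_sets[OF that refl, of "borel :: 'a measure"] by simp
  have live_sets: "emeasure (live M) B = emeasure M (Some ` (D \<inter> B))"
    if M: "sets M = sets ?E" and B: "B \<in> sets borel" for M B
  proof -
    note [measurable] = Y[OF M]
    have SD: "Some ` D \<in> sets M" using M Some_state_in_sets_cemetery by auto
    have SB: "Some ` (D \<inter> B) \<in> sets M"
      using M B Some_image_in_sets_cemetery[of "D \<inter> B" D] by (auto simp: sets_restrict_space)
    have YB: "Y -` B \<inter> space M \<in> sets M" using B by measurable
    have "emeasure (live M) B = emeasure (density M (indicator (Some ` D))) (Y -` B \<inter> space M)"
      unfolding live_def using B by (subst emeasure_distr) auto
    also have "\<dots> = (\<integral>\<^sup>+\<xi>. indicator (Some ` D) \<xi> * indicator (Y -` B \<inter> space M) \<xi> \<partial>M)"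
      using SD YB by (subst emeasure_density) auto
    also have "\<dots> = (\<integral>\<^sup>+\<xi>. indicator (Some ` (D \<inter> B)) \<xi> \<partial>M)"
      by (rule nn_integral_cong) (auto simp: indicator_def Y_def)
    finally show ?thesis using SB by simp
  qed
  have live_fin: "finite_measure (live M)" if "finite_measure M" "sets M = sets ?E" for M
  proof (rule finite_measureI)
    interpret finite_measure M by fact
    have "space (live M) = UNIV" by (simp add: live_def)
    then show "emeasure (live M) (space (live M)) \<noteq> \<infinity>"
      using live_sets[OF that(2), of UNIV] by simp
  qed
  have live_cos: "(\<integral>y. cos (v \<bullet> y + \<theta>) \<partial>live M) = (\<integral>\<xi>. zero_ext (\<lambda>y. cos (v \<bullet> y + \<theta>)) \<xi> \<partial>M)"
    if M: "sets M = sets ?E" for M v \<theta>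
  proof -
    note [measurable] = Y[OF M]
    have SD: "Some ` D \<in> sets M" using M Some_state_in_sets_cemetery by auto
    have "(\<integral>y. cos (v \<bullet> y + \<theta>) \<partial>live M)
        = (\<integral>\<xi>. cos (v \<bullet> Y \<xi> + \<theta>) \<partial>density M (\<lambda>\<xi>. ennreal (indicator (Some ` D) \<xi>)))"
      unfolding live_def by (subst integral_distr) (auto simp: ennreal_indicator)
    also have "\<dots> = (\<integral>\<xi>. indicator (Some ` D) \<xi> *\<^sub>R cos (v \<bullet> Y \<xi> + \<theta>) \<partial>M)"
      using SD by (subst integral_density) auto
    also have "\<dots> = (\<integral>\<xi>. zero_ext (\<lambda>y. cos (v \<bullet> y + \<theta>)) \<xi> \<partial>M)"
      using sets_eq_imp_space_eq[OF M]
      by (intro Bochner_Integration.integral_cong)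
         (auto simp: Y_def space_cemetery_measurable indicator_def split: option.splits)
    finally show ?thesis .
  qed
  have "live \<mu> = live \<nu>"
  proof (rule finite_measure_eqI_cos)
    show "(\<integral>y. cos (v \<bullet> y + \<theta>) \<partial>live \<mu>) = (\<integral>y. cos (v \<bullet> y + \<theta>) \<partial>live \<nu>)" for v \<theta>
      using eq by (auto simp: live_cos sets state_waves_def)
  qed (use live_fin fin sets in \<open>auto simp: live_def\<close>)
  then have live_eq: "emeasure \<mu> (Some ` B) = emeasure \<nu> (Some ` B)" if B: "B \<in> sets ?\<R>" for B
  proof -
    obtain B' where "B' \<in> sets borel" "B = D \<inter> B'" using B by (auto simp: sets_restrict_space)
    then show ?thesis using live_sets[of \<mu> B'] live_sets[of \<nu> B'] sets \<open>live \<mu> = live \<nu>\<close> by simp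
  qed
  have D\<R>: "D \<in> sets ?\<R>" using sets.top[of ?\<R>] by (simp add: space_restrict_space)
  have total: "measure \<mu> (space \<mu>) = measure \<nu> (space \<nu>)"
    using bspec[OF eq, of "\<lambda>_. 1"] by (simp add: state_waves_def)
  have None_mass: "measure M {None} = measure M (space M) - measure M (Some ` D)"
    if M: "finite_measure M" "sets M = sets ?E" for M
  proof -
    interpret finite_measure M by (rule M(1))
    have "measure M (space M - Some ` D) = measure M (space M) - measure M (Some ` D)"
      by (rule finite_measure_compl) (use M Some_state_in_sets_cemetery in auto)
    moreover have "space M - Some ` D = {None}"
      using sets_eq_imp_space_eq[OF M(2)] by (auto simp: space_cemetery_measurable)
    ultimately show ?thesis by simp
  qed
  have None_eq: "emeasure \<mu> {None} = emeasure \<nu> {None}"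
    using None_mass[OF fin(1) sets(1)] None_mass[OF fin(2) sets(2)] total live_eq[OF D\<R>]
    by (simp add: \<mu>.emeasure_eq_measure \<nu>.emeasure_eq_measure)
  let ?G = "insert {None} ((`) Some ` sets ?\<R>)"
  show "\<mu> = \<nu>"
  proof (rule measure_eqI_generator_eq[where E = ?G and A = "\<lambda>n. if n = 0 then {None} else Some ` D"])
    have empty: "{} \<in> (`) Some ` sets ?\<R>" by (metis image_empty imageI sets.empty_sets)
    have inter: "Some ` A \<inter> Some ` B \<in> (`) Some ` sets ?\<R>" if "A \<in> sets ?\<R>" "B \<in> sets ?\<R>" for A B
      using that by (metis image_Int inj_Some imageI sets.Int)
    have disj: "{None} \<inter> Some ` B = {}" "Some ` B \<inter> {None} = {}" for B :: "'a set" by auto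
    show "Int_stable ?G" unfolding Int_stable_def using empty inter by (auto simp: disj)
    show "?G \<subseteq> Pow (insert None (Some ` D))"
      by (rule cemetery_generator_subset)
    show "sets \<mu> = sigma_sets (insert None (Some ` D)) ?G" "sets \<nu> = sigma_sets (insert None (Some ` D)) ?G"
      using sets by (simp_all add: sets_cemetery_measurable)
    show "(\<Union>n::nat. if n = 0 then {None} else Some ` D) = insert None (Some ` D)" (is "(\<Union>n. ?A n) = _")
    proof -
      have "?A 0 \<union> ?A (Suc 0) \<subseteq> (\<Union>n. ?A n)" by blast
      then show ?thesis by (auto split: if_splits)
    qed
    show "range (\<lambda>n. if n = 0 then {None} else Some ` D) \<subseteq> ?G" using D\<R> by auto
  qed (use live_eq None_eq \<mu>.emeasure_finite in auto)
qed

lemma cadlag_path_in_space: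
  "\<omega> \<in> cadlag_paths D \<Longrightarrow> 0 \<le> s \<Longrightarrow> \<omega> s \<in> space (cemetery_measurable D)"
  by (auto simp: cadlag_paths_def space_cemetery_measurable PiE_def Pi_def)

lemma natural_generator_subset:
  "(\<Union>s\<in>{0..t}. sets (vimage_algebra (cadlag_paths D) (\<lambda>\<omega>. \<omega> s) (cemetery_measurable D)))
    \<subseteq> Pow (cadlag_paths D)"
  by (intro UN_least order_trans[OF sets.space_closed]) simp

lemma space_natural_filtration: "space (natural_filtration D t) = cadlag_paths D"
  unfolding natural_filtration_def
  by (rule space_measure_of[OF natural_generator_subset])

lemma sets_natural_filtration:
  "sets (natural_filtration D t) = sigma_sets (cadlag_paths D)
     (\<Union>s\<in>{0..t}. sets (vimage_algebra (cadlag_paths D) (\<lambda>\<omega>. \<omega> s) (cemetery_measurable D)))"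
  unfolding natural_filtration_def
  by (rule sets_measure_of[OF natural_generator_subset])

lemma coordinate_measurable_natural:
  assumes "0 \<le> s" "s \<le> t"
  shows "(\<lambda>\<omega>. \<omega> s) \<in> natural_filtration D t \<rightarrow>\<^sub>M cemetery_measurable D"
proof (rule measurableI)
  fix C assume "C \<in> sets (cemetery_measurable D)"
  then have "(\<lambda>\<omega>. \<omega> s) -` C \<inter> cadlag_paths D
      \<in> sets (vimage_algebra (cadlag_paths D) (\<lambda>\<omega>. \<omega> s) (cemetery_measurable D))"
    by (rule in_vimage_algebra)
  then show "(\<lambda>\<omega>. \<omega> s) -` C \<inter> space (natural_filtration D t) \<in> sets (natural_filtration D t)"
    using assms unfolding space_natural_filtration sets_natural_filtration
    by (intro sigma_sets.Basic UN_I[of s]) auto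
qed (use assms in \<open>auto simp: space_natural_filtration intro: cadlag_path_in_space\<close>)

lemma path_generator_subset:
  "(\<Union>t\<in>{0..}. sets (natural_filtration D t)) \<subseteq> Pow (cadlag_paths D)"
  by (intro UN_least order_trans[OF sets.space_closed]) (simp add: space_natural_filtration)

lemma space_path_algebra: "space (path_algebra D) = cadlag_paths D"
  unfolding path_algebra_def
  by (rule space_measure_of[OF path_generator_subset])

lemma sets_path_algebra:
  "sets (path_algebra D) = sigma_sets (cadlag_paths D) (\<Union>t\<in>{0..}. sets (natural_filtration D t))"
  unfolding path_algebra_def
  by (rule sets_measure_of[OF path_generator_subset])

lemma coordinate_measurable_path_algebra:
  assumes "0 \<le> s"
  shows "(\<lambda>\<omega>. \<omega> s) \<in> path_algebra D \<rightarrow>\<^sub>M cemetery_measurable D"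
proof (rule measurable_from_subalg[OF _ coordinate_measurable_natural[OF assms order_refl]])
  show "subalgebra (path_algebra D) (natural_filtration D s)"
    using assms
    by (auto simp: subalgebra_def space_path_algebra space_natural_filtration sets_path_algebra)
qed

definition cylinders :: "'a::euclidean_space set \<Rightarrow> 'a path set set" where
  "cylinders D = {{\<omega>\<in>cadlag_paths D. \<forall>s\<in>I. \<omega> s \<in> C s} |I C.
     finite I \<and> I \<subseteq> {0..} \<and> (\<forall>s\<in>I. C s \<in> sets (cemetery_measurable D))}"

lemma cylindersI:
  "finite I \<Longrightarrow> I \<subseteq> {0..} \<Longrightarrow> (\<And>s. s \<in> I \<Longrightarrow> C s \<in> sets (cemetery_measurable D)) \<Longrightarrow>
    B = {\<omega>\<in>cadlag_paths D. \<forall>s\<in>I. \<omega> s \<in> C s} \<Longrightarrow> B \<in> cylinders D"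
  unfolding cylinders_def by blast

lemma cylindersE:
  assumes "B \<in> cylinders D"
  obtains I C where "finite I" "I \<subseteq> {0..}" "\<forall>s\<in>I. C s \<in> sets (cemetery_measurable D)"
    "B = {\<omega>\<in>cadlag_paths D. \<forall>s\<in>I. \<omega> s \<in> C s}"
  using assms unfolding cylinders_def mem_Collect_eq by (elim exE conjE) (rule that)

lemma Int_stable_cylinders: "Int_stable (cylinders D)"
proof (rule Int_stableI)
  fix A B assume A: "A \<in> cylinders D" and B: "B \<in> cylinders D"
  from A obtain I C where I: "finite I" "I \<subseteq> {0..}" "\<forall>s\<in>I. C s \<in> sets (cemetery_measurable D)"
    "A = {\<omega>\<in>cadlag_paths D. \<forall>s\<in>I. \<omega> s \<in> C s}" by (rule cylindersE)
  from B obtain J K where J: "finite J" "J \<subseteq> {0..}" "\<forall>s\<in>J. K s \<in> sets (cemetery_measurable D)"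
    "B = {\<omega>\<in>cadlag_paths D. \<forall>s\<in>J. \<omega> s \<in> K s}" by (rule cylindersE)
  let ?S = "space (cemetery_measurable D)"
  show "A \<inter> B \<in> cylinders D"
  proof (rule cylindersI[of "I \<union> J" "\<lambda>s. (if s \<in> I then C s else ?S) \<inter> (if s \<in> J then K s else ?S)"])
    show "A \<inter> B = {\<omega>\<in>cadlag_paths D. \<forall>s\<in>I \<union> J.
        \<omega> s \<in> (if s \<in> I then C s else ?S) \<inter> (if s \<in> J then K s else ?S)}"
      using I(2,4) J(2,4) by (auto intro!: cadlag_path_in_space split: if_splits)
  qed (use I J in auto)
qed

lemma sets_path_algebra_cylinders:
  "sets (path_algebra D) = sigma_sets (cadlag_paths D) (cylinders D)"
proof
  have sub: "cylinders D \<subseteq> Pow (cadlag_paths D)" by (auto simp: cylinders_def)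
  interpret sigma_algebra "cadlag_paths D" "sigma_sets (cadlag_paths D) (cylinders D)"
    by (rule sigma_algebra_sigma_sets[OF sub])
  show "sets (path_algebra D) \<subseteq> sigma_sets (cadlag_paths D) (cylinders D)"
    unfolding sets_path_algebra
  proof (rule sigma_sets_subset, safe)
    fix t :: real and A assume "0 \<le> t" "A \<in> sets (natural_filtration D t)"
    have "sets (natural_filtration D t) \<subseteq> sigma_sets (cadlag_paths D) (cylinders D)"
      unfolding sets_natural_filtration
    proof (rule sigma_sets_subset, safe)
      fix s B assume s: "s \<in> {0..t}"
        and "B \<in> sets (vimage_algebra (cadlag_paths D) (\<lambda>\<omega>. \<omega> s) (cemetery_measurable D))"
      then obtain C where C: "C \<in> sets (cemetery_measurable D)"
        "B = (\<lambda>\<omega>. \<omega> s) -` C \<inter> cadlag_paths D"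
        by (subst (asm) sets_vimage_algebra2) (auto intro: cadlag_path_in_space)
      then have "B \<in> cylinders D"
        using s by (intro cylindersI[of "{s}" "\<lambda>_. C"]) auto
      then show "B \<in> sigma_sets (cadlag_paths D) (cylinders D)" by blast
    qed
    then show "A \<in> sigma_sets (cadlag_paths D) (cylinders D)"
      using \<open>A \<in> sets (natural_filtration D t)\<close> by blast
  qed
  show "sigma_sets (cadlag_paths D) (cylinders D) \<subseteq> sets (path_algebra D)"
  proof (subst space_path_algebra[symmetric], rule sets.sigma_sets_subset, rule subsetI)
    fix B assume "B \<in> cylinders D"
    then obtain I C where I: "finite I" "I \<subseteq> {0..}" "\<forall>s\<in>I. C s \<in> sets (cemetery_measurable D)"
      "B = {\<omega>\<in>cadlag_paths D. \<forall>s\<in>I. \<omega> s \<in> C s}" by (rule cylindersE)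
    have "{\<omega>\<in>space (path_algebra D). \<forall>s\<in>I. \<omega> s \<in> C s} \<in> sets (path_algebra D)"
    proof (rule sets.sets_Collect_finite_All[OF _ I(1)])
      fix s assume s: "s \<in> I"
      then show "{\<omega>\<in>space (path_algebra D). \<omega> s \<in> C s} \<in> sets (path_algebra D)"
        using measurable_sets[OF coordinate_measurable_path_algebra bspec[OF I(3) s]] I(2)
        by (auto simp: vimage_def Int_def conj_commute)
    qed
    then show "B \<in> sets (path_algebra D)" using I(4) by (simp add: space_path_algebra)
  qed
qed

text \<open>Continuity on \<open>D\<close> is enough: a path in the cemetery stays there, and a path at a point of \<open>D\<close>
  remains for a while in \<open>D\<close>, which is open in the compactification and keeps its topology there.\<close>
lemma cadlag_path_right_continuous:
  fixes h :: "'a::euclidean_space option \<Rightarrow> real"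
  assumes \<omega>: "\<omega> \<in> cadlag_paths D" and t: "0 \<le> t" and h: "continuous_on D (\<lambda>y. h (Some y))"
  shows "((\<lambda>s. h (\<omega> s)) \<longlongrightarrow> h (\<omega> t)) (at_right t)"
proof (cases "\<omega> t")
  case None
  then have "\<forall>s\<ge>t. \<omega> s = None" using \<omega> t by (auto simp: cadlag_paths_def)
  then have "\<forall>\<^sub>F s in at_right t. h (\<omega> s) = h (\<omega> t)"
    using None by (auto simp: eventually_at_filter)
  then show ?thesis by (rule tendsto_eventually)
next
  case (Some y)
  have y: "y \<in> D" using cadlag_path_in_space[OF \<omega> t] Some by (auto simp: space_cemetery_measurable)
  show ?thesis
  proof (rule topological_tendstoI)
    fix S assume S: "open S" "h (\<omega> t) \<in> S"
    let ?U = "D \<inter> (\<lambda>y. h (Some y)) -` S"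
    have "openin (cemetery_topology D) (Some ` ?U)"
      unfolding cemetery_topology_def openin_Alexandroff_compactification_image_Some
      by (rule continuous_openin_preimage_gen[OF h S(1)])
    moreover have "\<omega> t \<in> Some ` ?U" using y Some S(2) by auto
    moreover have "limitin (cemetery_topology D) \<omega> (\<omega> t) (at_right t)"
      using \<omega> t by (simp add: cadlag_paths_def)
    ultimately have "\<forall>\<^sub>F s in at_right t. \<omega> s \<in> Some ` ?U" by (auto simp: limitin_def)
    then show "\<forall>\<^sub>F s in at_right t. h (\<omega> s) \<in> S" by (rule eventually_mono) auto
  qed
qed

text \<open>The cylinders are an intersection-stable generator, so \<open>Z\<close> is orthogonal to all events of the
  path \<open>\<sigma>\<close>-algebra; each event of the completion differs from such an event by a null set.\<close>
lemma AE_zero_if_orthogonal_to_cylinders: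
  assumes P: "prob_space Px" "sets Px = sets (path_algebra D)"
    and Z: "integrable (completion Px) Z"
    and orth: "\<And>I f. finite I \<Longrightarrow> I \<subseteq> {0..} \<Longrightarrow>
      (\<And>s. s \<in> I \<Longrightarrow> f s \<in> bounded_measurable (cemetery_measurable D)) \<Longrightarrow>
      (\<integral>\<omega>. Z \<omega> * (\<Prod>s\<in>I. f s (\<omega> s)) \<partial>completion Px) = 0"
  shows "AE \<omega> in completion Px. Z \<omega> = (0 :: real)"
proof -
  interpret P: prob_space Px by (rule P)
  interpret Q: prob_space "completion Px" by (rule P.prob_space_completion)
  have space: "space Px = cadlag_paths D"
    using sets_eq_imp_space_eq[OF P(2)] by (simp add: space_path_algebra)
  have cyl: "(\<integral>\<omega>. Z \<omega> * indicator B \<omega> \<partial>completion Px) = 0" if "B \<in> cylinders D" for B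
  proof -
    from that obtain I C where I: "finite I" "I \<subseteq> {0..}" "\<forall>s\<in>I. C s \<in> sets (cemetery_measurable D)"
      "B = {\<omega>\<in>cadlag_paths D. \<forall>s\<in>I. \<omega> s \<in> C s}" by (rule cylindersE)
    have prod: "(\<Prod>s\<in>I. indicator (C s) (\<omega> s)) = (indicator B \<omega> :: real)"
      if "\<omega> \<in> space (completion Px)" for \<omega>
    proof (cases "\<omega> \<in> B")
      case True
      then show ?thesis using I by simp
    next
      case False
      then have "\<exists>s\<in>I. indicator (C s) (\<omega> s) = (0 :: real)" using that I(4) by (auto simp: space indicator_def)
      then show ?thesis using False I(1) by (simp add: prod_zero)
    qed
    have "(\<integral>\<omega>. Z \<omega> * indicator B \<omega> \<partial>completion Px)
        = (\<integral>\<omega>. Z \<omega> * (\<Prod>s\<in>I. indicator (C s) (\<omega> s)) \<partial>completion Px)"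
      by (rule Bochner_Integration.integral_cong) (simp_all add: prod)
    also have "\<dots> = 0" using I by (intro orth) (auto intro: bounded_measurable_indicator)
    finally show ?thesis .
  qed
  \<comment> \<open>The identity map, seen as a random variable with values in path space, turns
    orthogonality to cylinders into orthogonality to all events.\<close>
  have event: "(\<integral>\<omega>. Z \<omega> * indicator B \<omega> \<partial>completion Px) = 0" if B: "B \<in> sets Px" for B
  proof (rule Q.determining_orthogonal[where E = "path_algebra D" and X = "\<lambda>\<omega>. \<omega>" and f = "indicator B"])
    have sub: "cylinders D \<subseteq> sets (path_algebra D)" by (auto simp: sets_path_algebra_cylinders)
    show "measure_determining (path_algebra D) (indicator ` cylinders D)"
    proof (rule measure_determining_indicators[OF Int_stable_cylinders _ _ sets_path_algebra_cylinders])
      show "cylinders D \<subseteq> Pow (cadlag_paths D)" by (auto simp: cylinders_def)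
      show "cadlag_paths D \<in> cylinders D" by (rule cylindersI[of "{}"]) auto
    qed
    show "indicator ` cylinders D \<subseteq> bounded_measurable (path_algebra D)"
      using sub by (auto intro: bounded_measurable_indicator)
    have "(\<lambda>\<omega>. \<omega>) \<in> completion Px \<rightarrow>\<^sub>M Px" by (rule measurable_completion) simp
    then show "(\<lambda>\<omega>. \<omega>) \<in> completion Px \<rightarrow>\<^sub>M path_algebra D"
      using measurable_cong_sets[OF refl P(2), of "completion Px"] by simp
    show "indicator B \<in> bounded_measurable (path_algebra D)"
      using B P(2) by (auto intro: bounded_measurable_indicator)
  qed (use Z cyl in auto)
  have "AE \<omega> in completion Px. Z \<omega> = (\<lambda>_. 0) \<omega>"
  proof (rule density_unique_real)
    fix A assume A: "A \<in> sets (completion Px)"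
    have "(\<integral>\<omega>\<in>A. Z \<omega> \<partial>completion Px) = (\<integral>\<omega>. Z \<omega> * indicator (main_part Px A) \<omega> \<partial>completion Px)"
      unfolding set_lebesgue_integral_def
    proof (rule integral_cong_AE)
      have "AE \<omega> in completion Px. \<omega> \<notin> null_part Px A"
        using AE_notin_null_part[OF A] by (rule AE_completion)
      then show "AE \<omega> in completion Px. indicator A \<omega> *\<^sub>R Z \<omega> = Z \<omega> * indicator (main_part Px A) \<omega>"
        by (rule eventually_mono)
           (use main_part_null_part_Un[OF A] in \<open>auto simp: indicator_def\<close>)
      have "main_part Px A \<in> sets (completion Px)" using main_part_sets[OF A] by auto
      then show "(\<lambda>\<omega>. Z \<omega> * indicator (main_part Px A) \<omega>) \<in> borel_measurable (completion Px)"
        using Z by (intro borel_measurable_times) auto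
      show "(\<lambda>\<omega>. indicator A \<omega> *\<^sub>R Z \<omega>) \<in> borel_measurable (completion Px)"
        using Z A by (intro borel_measurable_scaleR) auto
    qed
    also have "\<dots> = 0" by (rule event[OF main_part_sets[OF A]])
    finally show "(\<integral>\<omega>\<in>A. Z \<omega> \<partial>completion Px) = (\<integral>\<omega>\<in>A. 0 \<partial>completion Px)"
      by (simp add: set_lebesgue_integral_def)
  qed (use Z in auto)
  then show ?thesis by simp
qed

section \<open>Affine processes\<close>

lemma transition_function_prob_space:
  assumes p: "transition_function D p" and t: "0 \<le> t" and y: "y \<in> insert None (Some ` D)"
  shows "prob_space (p t y)" "sets (p t y) = sets (cemetery_measurable D)"
proof -
  have "p t y \<in> space (subprob_algebra (cemetery_measurable D))"
    using p t y by (intro measurable_space[of "p t" "cemetery_measurable D"])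
      (auto simp: transition_function_def space_cemetery_measurable)
  then have sub: "subprob_space (p t y)" and sets: "sets (p t y) = sets (cemetery_measurable D)"
    by (auto simp: space_subprob_algebra)
  show "sets (p t y) = sets (cemetery_measurable D)" by (rule sets)
  interpret subprob_space "p t y" by (rule sub)
  have sp: "space (p t y) = insert None (Some ` D)"
    using sets_eq_imp_space_eq[OF sets] by (simp add: space_cemetery_measurable)
  have "measure (p t y) ({None} \<union> Some ` D) = measure (p t y) {None} + measure (p t y) (Some ` D)"
    using sets None_in_sets_cemetery Some_state_in_sets_cemetery
    by (intro finite_measure_Union) auto
  moreover have "measure (p t y) {None} = 1 - measure (p t y) (Some ` D)"
    using p t y by (auto simp: transition_function_def)
  ultimately have "measure (p t y) (space (p t y)) = 1" by (simp add: sp)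
  then show "prob_space (p t y)" by (intro prob_spaceI) (simp add: emeasure_eq_measure)
qed

text \<open>A wave is the real part of a multiple of \<open>exp(i\<langle>v, \<cdot>\<rangle>)\<close>, whose image under the kernel is by
  affinity a multiple of an exponential of a linear function of the starting point. The kernel maps
  the constant to itself because the cemetery carries the missing mass.\<close>
lemma affine_kernel_continuous:
  assumes p: "transition_function D p" and aff: "exponentially_affine D P p \<Phi> \<psi>" and t: "0 \<le> t"
    and f: "f \<in> state_waves"
  shows "continuous_on D (\<lambda>y. \<integral>\<xi>. f \<xi> \<partial>p t (Some y))"
  using f unfolding state_waves_def
proof (rule insertE)
  assume f: "f = (\<lambda>_. 1)"
  have "(\<integral>\<xi>. f \<xi> \<partial>p t (Some y)) = 1" if y: "y \<in> D" for y
  proof -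
    interpret prob_space "p t (Some y)" using transition_function_prob_space[OF p t] y by auto
    show ?thesis by (simp add: f prob_space)
  qed
  then show ?thesis by (simp cong: continuous_on_cong_simp)
next
  assume "f \<in> {zero_ext (\<lambda>y. cos (v \<bullet> y + \<theta>)) |v \<theta>. True}"
  then obtain v \<theta> where f: "f = zero_ext (\<lambda>y. cos (v \<bullet> y + \<theta>))" by auto
  \<comment> \<open>The purely imaginary exponent \<open>iv\<close>.\<close>
  define u :: "'a complexified" where "u = (0, v)"
  have exp_u: "exp (cpair u y) = cis (v \<bullet> y)" for y
    by (simp add: u_def cpair_def cis_conv_exp complex_eq_iff Re_exp Im_exp)
  have norm_u: "\<forall>z\<in>(\<lambda>y. exp (cpair u y)) ` D. norm z \<le> 1" by (simp only: exp_u) simp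
  have u: "u \<in> bounded_exponents D"
    unfolding bounded_exponents_def using norm_u by (auto simp only: bounded_iff mem_Collect_eq)
  let ?g = "zero_ext (\<lambda>y. exp (cpair u y)) :: 'a option \<Rightarrow> complex"
  have "(\<integral>\<xi>. f \<xi> \<partial>p t (Some y)) = Re (cis \<theta> * (\<Phi> t u * exp (cpair (\<psi> t u) y)))" if y: "y \<in> D" for y
  proof -
    interpret prob_space "p t (Some y)" using transition_function_prob_space[OF p t] y by auto
    have sets: "sets (p t (Some y)) = sets (cemetery_measurable D)"
      using transition_function_prob_space[OF p t] y by auto
    have "?g \<in> borel_measurable (cemetery_measurable D)"
      unfolding exp_u by (rule zero_ext_measurable) (auto intro!: borel_measurable_continuous_onI continuous_intros)
    then have "?g \<in> borel_measurable (p t (Some y))"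
      using measurable_cong_sets[OF sets refl, of "borel :: complex measure"] by simp
    moreover have "norm (?g \<xi>) \<le> 1" for \<xi> by (cases \<xi>) (auto simp: exp_u)
    ultimately have int: "integrable (p t (Some y)) ?g" by (intro integrable_const_bound[of _ 1]) auto
    have "f \<xi> = Re (cis \<theta> * ?g \<xi>)" for \<xi>
      by (cases \<xi>) (auto simp: f exp_u cos_add algebra_simps)
    then have "(\<integral>\<xi>. f \<xi> \<partial>p t (Some y)) = (\<integral>\<xi>. Re (cis \<theta> * ?g \<xi>) \<partial>p t (Some y))" by simp
    also have "\<dots> = Re (\<integral>\<xi>. cis \<theta> * ?g \<xi> \<partial>p t (Some y))"
      by (rule integral_Re) (use int in simp)
    also have "(\<integral>\<xi>. cis \<theta> * ?g \<xi> \<partial>p t (Some y)) = cis \<theta> * (\<integral>\<xi>. ?g \<xi> \<partial>p t (Some y))"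
      by (rule integral_mult_right_zero)
    also have "(\<integral>\<xi>. ?g \<xi> \<partial>p t (Some y)) = \<Phi> t u * exp (cpair (\<psi> t u) y)"
      using aff y t u by (simp add: exponentially_affine_def)
    finally show ?thesis .
  qed
  moreover have "continuous_on D (\<lambda>y. Re (cis \<theta> * (\<Phi> t u * exp (cpair (\<psi> t u) y))))"
    unfolding cpair_def Complex_eq by (intro continuous_intros)
  ultimately show ?thesis by (simp cong: continuous_on_cong_simp)
qed

lemma affine_process_markov_wrt_filtration:
  assumes aff: "affine_process D P p F" and x: "x \<in> insert None (Some ` D)"
  shows "markov_wrt_filtration (completion (P x)) (F x) (cemetery_measurable D) (\<lambda>s \<omega>. \<omega> s) p"
proof -
  have P: "P x \<in> space (prob_algebra (path_algebra D))"
    and adm: "admissible_filtration D (P x) (F x)" and markov: "markov_property D P p x (F x)"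
    and p: "transition_function D p"
    using aff x by (auto simp: affine_process_def markov_process_def path_laws_def)
  interpret P: prob_space "P x" using P by (simp add: space_prob_algebra)
  interpret Q: prob_space "completion (P x)" by (rule P.prob_space_completion)
  have sub: "subalgebra (completion (P x)) (F x s)" if "0 \<le> s" for s
    using adm that by (simp add: admissible_filtration_def)
  show ?thesis
  proof unfold_locales
    show "subalgebra (completion (P x)) (F x s)" if "0 \<le> s" for s by (rule sub[OF that])
    show "sets (F x s) \<subseteq> sets (F x t)" if "0 \<le> s" "s \<le> t" for s t
      using adm that by (simp add: admissible_filtration_def)
    show "(\<lambda>\<omega>. \<omega> s) \<in> F x s \<rightarrow>\<^sub>M cemetery_measurable D" if s: "0 \<le> s" for s
    proof (rule measurable_from_subalg[OF _ coordinate_measurable_natural[OF s order_refl]])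
      have "space (P x) = cadlag_paths D"
        using P by (auto simp: space_prob_algebra space_path_algebra dest: sets_eq_imp_space_eq)
      then show "subalgebra (F x s) (natural_filtration D s)"
        using adm sub[OF s] s
        by (auto simp: admissible_filtration_def subalgebra_def space_natural_filtration)
    qed
    show "p t \<in> cemetery_measurable D \<rightarrow>\<^sub>M subprob_algebra (cemetery_measurable D)" if "0 \<le> t" for t
      using p that by (simp add: transition_function_def)
    show "AE \<omega> in completion (P x).
        real_cond_exp (completion (P x)) (F x s) (\<lambda>\<omega>. f (\<omega> (t + s))) \<omega> = (\<integral>\<xi>. f \<xi> \<partial>p t (\<omega> s))"
      if st: "0 \<le> s" "0 \<le> t" and f: "f \<in> bounded_measurable (cemetery_measurable D)" for s t f
    proof (rule AE_completion)
      have "bounded (f ` insert None (Some ` D))"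
        using f by (auto simp: bounded_measurable_def bounded_real space_cemetery_measurable)
      then have "AE \<omega> in P x.
          real_cond_exp (completion (P x)) (F x s) (\<lambda>\<omega>. f (\<omega> (t + s))) \<omega>
            = (\<integral>\<omega>'. f (\<omega>' t) \<partial>P (\<omega> s)) \<and>
          (\<integral>\<omega>'. f (\<omega>' t) \<partial>P (\<omega> s)) = (\<integral>\<xi>. f \<xi> \<partial>p t (\<omega> s))"
        using markov st bounded_measurable_measurable[OF f] unfolding markov_property_def by blast
      then show "AE \<omega> in P x. real_cond_exp (completion (P x)) (F x s) (\<lambda>\<omega>. f (\<omega> (t + s))) \<omega>
          = (\<integral>\<xi>. f \<xi> \<partial>p t (\<omega> s))"
        by (rule eventually_mono) auto
    qed
  qed
qed

lemma null_sets_in_augmented_filtration: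
  assumes "sets (P x) = sets (path_algebra D)"
  shows "null_sets (completion (P x)) \<subseteq> sets (augmented_filtration D P x t)"
proof -
  have "space (P x) = cadlag_paths D"
    using sets_eq_imp_space_eq[OF assms] by (simp add: space_path_algebra)
  then have "null_sets (completion (P x)) \<subseteq> Pow (cadlag_paths D)"
    using sets.sets_into_space[of _ "completion (P x)"] by (auto dest: null_setsD2)
  moreover have "sets (natural_filtration D t) \<subseteq> Pow (cadlag_paths D)"
    using sets.space_closed[of "natural_filtration D t"] by (simp add: space_natural_filtration)
  ultimately show ?thesis
    unfolding augmented_filtration_def by (subst sets_measure_of) auto
qed

theorem theorem4p1:
  fixes D :: "'a::euclidean_space set"
    and P :: "'a option \<Rightarrow> 'a path measure"
    and p :: "real \<Rightarrow> 'a option \<Rightarrow> 'a option measure"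
    and x :: 'a
  assumes "state_space D"
    and "affine_process D P p (augmented_filtration D P)"
    and "x \<in> D"
  shows "\<forall>t\<ge>0. (\<Inter>s\<in>{t<..}. sets (augmented_filtration D P (Some x) s))
                 = sets (augmented_filtration D P (Some x) t)"
proof (intro allI impI)
  fix t :: real assume t: "0 \<le> t"
  note aff = assms(2)
  let ?P = "P (Some x)" and ?E = "cemetery_measurable D"
  have p: "transition_function D p" and P: "prob_space ?P" "sets ?P = sets (path_algebra D)"
    using aff assms(3)
    by (auto simp: affine_process_def markov_process_def path_laws_def space_prob_algebra)
  obtain \<Phi> \<psi> where exp_aff: "exponentially_affine D P p \<Phi> \<psi>"
    using aff by (auto simp: affine_process_def)
  interpret markov_wrt_filtration "completion ?P" "augmented_filtration D P (Some x)" ?E "\<lambda>s \<omega>. \<omega> s" p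
    using aff assms(3) by (intro affine_process_markov_wrt_filtration) auto
  have paths: "space (completion ?P) = cadlag_paths D"
    using sets_eq_imp_space_eq[OF P(2)] by (simp add: space_path_algebra)
  have regular: "right_regular s h" if "0 \<le> s" "continuous_on D (\<lambda>y. h (Some y))" for s h
    unfolding right_regular_def paths using that by (auto intro: cadlag_path_right_continuous)
  have wave_regular: "right_regular s f" if "f \<in> state_waves" "0 \<le> s" for f s
    using that by (intro regular) (auto simp: state_waves_def intro!: continuous_intros)
  have kernel_regular: "right_regular s (\<lambda>y. \<integral>z. f z \<partial>p r y)"
    if "f \<in> state_waves" "0 \<le> s" "0 \<le> r" for f r s
    using that by (intro regular affine_kernel_continuous[OF p exp_aff])
  show "(\<Inter>s\<in>{t<..}. sets (augmented_filtration D P (Some x) s))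
      = sets (augmented_filtration D P (Some x) t)"
  proof (rule right_continuous_if_germ_orthogonal_zero[OF t])
    show "null_sets (completion ?P) \<subseteq> sets (augmented_filtration D P (Some x) t)"
      by (rule null_sets_in_augmented_filtration[where P = P and x = "Some x", OF P(2)])
    fix Z assume Z: "germ_orthogonal t Z"
    show "AE \<omega> in completion ?P. Z \<omega> = 0"
    proof (rule AE_zero_if_orthogonal_to_cylinders[OF P])
      show "integrable (completion ?P) Z" using Z by (simp add: germ_orthogonal_def)
    qed (rule germ_orthogonal_finite_times[OF t Z measure_determining_state_waves
          state_waves_bounded_measurable wave_regular kernel_regular])
  qed
qed

end
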